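(* Suppose $U$ satisfies Assumption (U) and $G$ satisfies Assumption (G1) (see context). 1. (Multi-particle.) Let $N\ge2$. For $(\mathbf{q}_0,\mathbf{p}_0)\in\mathbf{X}$ let $(\mathbf{q}^\varepsilon(t),\mathbf{p}^\varepsilon(t))$ solve the relativistic system and $(\mathbf{q}(t),\mathbf{p}(t))$ solve the Langevin system (see context), both started at $(\mathbf{q}_0,\mathbf{p}_0)$ and driven by the same Brownian motions. Then for all $T>0$ and $\xi>0$, $$\mathbb{P}\Big(\sup_{t\in[0,T]}\big[|\mathbf{q}^\varepsilon(t)-\mathbf{q}(t)|+|\mathbf{p}^\varepsilon(t)-\mathbf{p}(t)|\big]>\xi\Big)\to0\quad\text{as }\varepsilon\to0.$$ 2. (Single-particle.) Let $N=1$. For $(q_0,p_0)\in(\mathbb{R}^d\setminus\{0\})\times\mathbb{R}^d$ let $(q^\varepsilon,p^\varepsilon)$ and $(q,p)$ solve the single-particle relativistic and Langevin systems (see context) with initial condition $(q_0,p_0)$ and the same Brownian motion. Then for all $T>0$ and $n\ge1$, $$\mathbb{E}\sup_{t\in[0,T]}\big[|q^\varepsilon(t)-q(t)|^n+|p^\varepsilon(t)-p(t)|^n\big]\to0\quad\text{as }\varepsilon\to0.$$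
   Context: Assumption (U): $U\in C^\infty(\mathbb{R}^d;[1,\infty))$ and there are constants $a_1>0$, $\lambda\ge 1$, $a_2,a_3>0$ such that for all $q$: $\frac{1}{a_1}|q|^{\lambda+1}-a_1\le |U(q)|\le a_1(1+|q|^{\lambda+1})$, $|\nabla U(q)|\le a_1(1+|q|^\lambda)$, $\langle\nabla U(q),q\rangle\ge a_2|q|^{\lambda+1}-a_3$. Assumption (G1): $G\in C^\infty(\mathbb{R}^d\setminus\{0\};\mathbb{R})$, $G(q)\to\infty$ as $|q|\to0$, $G$ even, $\nabla G$ odd; there is $\beta_1\ge1$ with $|G(q)|\le a_1(1+|q|+|q|^{-\beta_1})$, $|\nabla G(q)|\le a_1(1+|q|^{-\beta_1})$; and constants $\beta_2\in[0,\beta_1)$, $a_4>0$, $a_5\in\mathbb{R}$, $a_6>0$ with $\big|\nabla G(q)+a_4\frac{q}{|q|^{\beta_1+1}}+a_5\frac{q}{|q|^{\beta_2+1}}\big|\le a_6$ for $q\ne0$. For $N\ge2$: $\mathcal{D}=\{\mathbf{q}\in(\mathbb{R}^d)^N:q_i\ne q_j\ (i\ne j)\}$, $\mathbf{X}=\mathcal{D}\times(\mathbb{R}^d)^N$; $W_1,\dots,W_N$ i.i.d. standard $d$-dimensional Brownian motions. Relativistic system ($\varepsilon\in(0,1)$): $dq_i=\frac{p_i}{\sqrt{1+\varepsilon|p_i|^2}}dt$, $dp_i=-\frac{p_i}{\sqrt{1+\varepsilon|p_i|^2}}dt-\nabla U(q_i)dt-\sum_{j\ne i}\nabla G(q_i-q_j)dt+\sqrt2\,dW_i$.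 Langevin system: $dq_i=p_i\,dt$, $dp_i=-p_i\,dt-\nabla U(q_i)dt-\sum_{j\ne i}\nabla G(q_i-q_j)dt+\sqrt2\,dW_i$. For $N=1$: relativistic system $dq=\frac{p}{\sqrt{1+\varepsilon|p|^2}}dt$, $dp=-\frac{p}{\sqrt{1+\varepsilon|p|^2}}dt-\nabla U(q)dt-\nabla G(q)dt+\sqrt2\,dW$; Langevin system $dq=p\,dt$, $dp=-p\,dt-\nabla U(q)dt-\nabla G(q)dt+\sqrt2\,dW$. *)

theory Defs
  imports "HOL-Analysis.Analysis" "HOL-Probability.Probability"
begin

fun iter_dd :: "('a::real_normed_vector \<Rightarrow> real) \<Rightarrow> 'a list \<Rightarrow> 'a \<Rightarrow> real" where
  "iter_dd f [] = f"
| "iter_dd f (v # vs) = (\<lambda>x. frechet_derivative (iter_dd f vs) (at x) v)"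

definition smooth_on :: "'a::real_normed_vector set \<Rightarrow> ('a \<Rightarrow> real) \<Rightarrow> bool" where
  "smooth_on S f \<longleftrightarrow> (\<forall>vs. \<forall>x\<in>S. iter_dd f vs differentiable (at x))"

definition gauss_density :: "real \<Rightarrow> 'b::euclidean_space \<Rightarrow> real" where
  "gauss_density s x = (2 * pi * s) powr (- real DIM('b) / 2) * exp (- (norm x)\<^sup>2 / (2 * s))"

definition std_BM :: "'a measure \<Rightarrow> (real \<Rightarrow> 'a \<Rightarrow> 'b::euclidean_space) \<Rightarrow> bool" where
  "std_BM M W \<longleftrightarrow> prob_space M
    \<and> (\<forall>t. W t \<in> borel_measurable M)
    \<and> (\<forall>\<omega>\<in>space M. W 0 \<omega> = 0 \<and> continuous_on {0..} (\<lambda>t. W t \<omega>))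
    \<and> (\<forall>s t. 0 \<le> s \<and> s < t \<longrightarrow>
          distributed M lborel (\<lambda>\<omega>. W t \<omega> - W s \<omega>) (\<lambda>x. ennreal (gauss_density (t - s) x)))
    \<and> (\<forall>n (\<tau>::nat \<Rightarrow> real). 0 \<le> \<tau> 0 \<and> (\<forall>i<n. \<tau> i \<le> \<tau> (Suc i)) \<longrightarrow>
          prob_space.indep_vars M (\<lambda>_. borel) (\<lambda>i \<omega>. W (\<tau> (Suc i)) \<omega> - W (\<tau> i) \<omega>) {..<n})"

definition iid_BMs :: "'a measure \<Rightarrow> (real \<Rightarrow> 'a \<Rightarrow> real^'d^'n) \<Rightarrow> bool" where
  "iid_BMs M W \<longleftrightarrow> (\<forall>i. std_BM M (\<lambda>t \<omega>. W t \<omega> $ i))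
    \<and> prob_space.indep_vars M (\<lambda>_. Pi\<^sub>M UNIV (\<lambda>_. (borel :: (real^'d) measure)))
         (\<lambda>i \<omega>. (\<lambda>t. W t \<omega> $ i)) UNIV"

definition rel_vel :: "real \<Rightarrow> real^'d \<Rightarrow> real^'d" where
  "rel_vel \<epsilon> p = (1 / sqrt (1 + \<epsilon> * (norm p)\<^sup>2)) *\<^sub>R p"

definition rel_vel_multi :: "real \<Rightarrow> real^'d^'n \<Rightarrow> real^'d^'n" where
  "rel_vel_multi \<epsilon> P = (\<chi> i. rel_vel \<epsilon> (P $ i))"

definition force_multi :: "(real^'d \<Rightarrow> real^'d) \<Rightarrow> (real^'d \<Rightarrow> real^'d) \<Rightarrow> real^'d^'n \<Rightarrow> real^'d^'n" where
  "force_multi gU gG Q = (\<chi> i. gU (Q $ i) + (\<Sum>j\<in>UNIV - {i}. gG (Q $ i - Q $ j)))"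

definition coll_free :: "(real^'d^'n) set" where
  "coll_free = {Q. \<forall>i j. i \<noteq> j \<longrightarrow> Q $ i \<noteq> Q $ j}"

text \<open>(q,p) is a (pathwise, integral-form) solution on [0,\<infinity>) of
   dq = vel(p) dt,  dp = -vel(p) dt - F(q) dt + sqrt 2 dW,  q(0)=q0, p(0)=p0,
  staying in the domain S for all times; the processes are random variables at each
  time and have continuous paths.\<close>
definition solves :: "'a measure \<Rightarrow> ('v::euclidean_space \<Rightarrow> 'v) \<Rightarrow> ('v \<Rightarrow> 'v) \<Rightarrow> 'v set
    \<Rightarrow> (real \<Rightarrow> 'a \<Rightarrow> 'v) \<Rightarrow> 'v \<Rightarrow> 'v \<Rightarrow> (real \<Rightarrow> 'a \<Rightarrow> 'v) \<Rightarrow> (real \<Rightarrow> 'a \<Rightarrow> 'v) \<Rightarrow> bool" where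
  "solves M vel F S W q0 p0 q p \<longleftrightarrow>
     (\<forall>t. q t \<in> borel_measurable M \<and> p t \<in> borel_measurable M)
   \<and> (\<forall>\<omega>\<in>space M. continuous_on {0..} (\<lambda>t. q t \<omega>) \<and> continuous_on {0..} (\<lambda>t. p t \<omega>))
   \<and> (AE \<omega> in M. \<forall>t\<ge>0. q t \<omega> \<in> S
        \<and> q t \<omega> = q0 + integral {0..t} (\<lambda>s. vel (p s \<omega>))
        \<and> p t \<omega> = p0 + integral {0..t} (\<lambda>s. - vel (p s \<omega>) - F (q s \<omega>)) + sqrt 2 *\<^sub>R W t \<omega>)"

end

theory Submission
  imports Defs
begin

text \<open>
  The noise is additive, so everything is pathwise. On \<open>[0, T]\<close> the limiting path has compact image in
  the open set where the force is locally Lipschitz, and the relativistic velocities are nonexpansive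
  and converge to the classical one uniformly on compact sets; Gronwall's inequality up to the exit
  from a tube around the limiting path gives uniform convergence for almost every noise path. This
  already implies convergence in probability.

  For convergence of moments one needs an \<open>\<epsilon>\<close>-independent integrable bound on the paths. Replace
  \<open>\<surd>2 W\<close> by its moving average over a window \<open>\<delta>\<close> so short that the error \<open>h\<close> is uniformly small, and
  put \<open>y = p - h\<close>. The energy \<open>E = K(y) + U(q) + G(q)\<close> then grows at most at rate \<open>|h| |\<nabla>G(q)|\<close> plus
  harmless terms, and the singular term is compensated by the radial momentum \<open>Z = \<langle>y, q/|q|\<rangle>\<close>,
  whose derivative is at least a multiple of \<open>|q|\<^bsup>-\<beta>\<^esup>\<close> because \<open>G\<close> is repulsive. So, for a small
  multiple \<open>\<kappa>\<close>, the growth of \<open>E - \<kappa> Z\<close> is controlled, and the paths are bounded by a multiple of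
  \<open>1 + \<delta>\<^bsup>-2\<^esup>\<close>. Kolmogorov's chaining argument shows that \<open>1/\<delta>\<close> has moments of all orders, so
  dominated convergence applies.
\<close>

section \<open>Continuously differentiable vector fields\<close>

definition continuously_differentiable_on ::
    "'a::real_normed_vector set \<Rightarrow> ('a \<Rightarrow> 'b::real_normed_vector) \<Rightarrow> bool" where
  "continuously_differentiable_on S F \<longleftrightarrow>
     (\<exists>F'. (\<forall>x\<in>S. (F has_derivative blinfun_apply (F' x)) (at x)) \<and> continuous_on S F')"

lemma continuously_differentiable_on_sum:
  assumes "\<And>i. i \<in> I \<Longrightarrow> continuously_differentiable_on S (F i)"
  shows "continuously_differentiable_on S (\<lambda>x. \<Sum>i\<in>I. F i x)"
proof -
  have "\<exists>F'. \<forall>i\<in>I. (\<forall>x\<in>S. (F i has_derivative blinfun_apply (F' i x)) (at x))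
      \<and> continuous_on S (F' i)"
    using assms by (intro bchoice) (simp add: continuously_differentiable_on_def)
  then obtain F' where F': "\<forall>i\<in>I. (\<forall>x\<in>S. (F i has_derivative blinfun_apply (F' i x)) (at x))
      \<and> continuous_on S (F' i)" ..
  have "((\<lambda>x. \<Sum>i\<in>I. F i x) has_derivative blinfun_apply (\<Sum>i\<in>I. F' i x)) (at x)" if "x \<in> S" for x
  proof -
    have "((\<lambda>x. \<Sum>i\<in>I. F i x) has_derivative (\<lambda>h. \<Sum>i\<in>I. blinfun_apply (F' i x) h)) (at x)"
      using F' that by (intro has_derivative_sum) simp
    then show ?thesis by (rule has_derivative_eq_rhs) (simp add: fun_eq_iff blinfun.sum_left)
  qed
  moreover have "continuous_on S (\<lambda>x. \<Sum>i\<in>I. F' i x)"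
    using F' by (intro continuous_on_sum) simp
  ultimately show ?thesis
    unfolding continuously_differentiable_on_def
    by (intro exI[of _ "\<lambda>x. \<Sum>i\<in>I. F' i x"]) simp
qed

lemma continuously_differentiable_on_add:
  assumes "continuously_differentiable_on S F" "continuously_differentiable_on S G"
  shows "continuously_differentiable_on S (\<lambda>x. F x + G x)"
proof -
  have "continuously_differentiable_on S (\<lambda>x. \<Sum>b\<in>UNIV. if b then F x else G x)"
    by (rule continuously_differentiable_on_sum, rule bool.induct) (simp_all add: assms)
  then show ?thesis by (simp add: UNIV_bool add.commute)
qed

lemma continuously_differentiable_on_subset:
  "continuously_differentiable_on S F \<Longrightarrow> R \<subseteq> S \<Longrightarrow> continuously_differentiable_on R F"
  unfolding continuously_differentiable_on_def
  by (elim exE conjE, intro exI) (auto elim: continuous_on_subset)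

lemma continuously_differentiable_on_compose_linear:
  assumes F: "continuously_differentiable_on R F"
    and a: "bounded_linear a" and b: "bounded_linear b" and bS: "b ` S \<subseteq> R"
  shows "continuously_differentiable_on S (\<lambda>x. a (F (b x)))"
proof -
  obtain F' where F': "\<And>x. x \<in> R \<Longrightarrow> (F has_derivative blinfun_apply (F' x)) (at x)"
    and cont: "continuous_on R F'"
    using F unfolding continuously_differentiable_on_def by blast
  let ?D = "\<lambda>x. Blinfun a o\<^sub>L F' (b x) o\<^sub>L Blinfun b"
  have "((\<lambda>x. a (F (b x))) has_derivative blinfun_apply (?D x)) (at x)" if x: "x \<in> S" for x
  proof -
    have "((\<lambda>x. F (b x)) has_derivative (\<lambda>h. F' (b x) (b h))) (at x)"
      using has_derivative_compose[OF bounded_linear_imp_has_derivative[OF b] F'[of "b x"]] bS x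
      by blast
    from bounded_linear.has_derivative[OF a this] show ?thesis
      by (rule has_derivative_eq_rhs)
        (simp add: fun_eq_iff bounded_linear_Blinfun_apply[OF a] bounded_linear_Blinfun_apply[OF b])
  qed
  moreover have "continuous_on S ?D"
    by (intro continuous_intros continuous_on_compose2[OF cont] linear_continuous_on[OF b] bS)
  ultimately show ?thesis
    unfolding continuously_differentiable_on_def by (intro exI[of _ ?D]) simp
qed

lemma iter_dd_singleton:
  assumes "GDERIV f x :> g"
  shows "iter_dd f [v] x = g \<bullet> v"
  using frechet_derivative_at[OF assms[unfolded gderiv_def], symmetric] by (simp add: inner_commute)

lemma smooth_on_imp_gradient_continuously_differentiable:
  fixes f :: "'a::euclidean_space \<Rightarrow> real"
  assumes smooth: "smooth_on S f" and S: "open S" and g: "\<And>x. x \<in> S \<Longrightarrow> GDERIV f x :> g x"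
  shows "continuously_differentiable_on S g"
proof -
  define H where "H = (\<lambda>x h. \<Sum>b\<in>Basis. iter_dd f [h, b] x *\<^sub>R b)"
  have partial_derivative: "(iter_dd f [b] has_derivative (\<lambda>h. iter_dd f [h, b] x)) (at x)"
    if "x \<in> S" for b x
    unfolding iter_dd.simps(2)[of f _ "[b]"]
    by (rule frechet_derivative_works[THEN iffD1]) (use smooth that in \<open>unfold smooth_on_def, blast\<close>)
  have H_derivative: "(g has_derivative H x) (at x)" if "x \<in> S" for x
  proof (rule has_derivative_transform_within_open[OF _ S that])
    show "((\<lambda>z. \<Sum>b\<in>Basis. iter_dd f [b] z *\<^sub>R b) has_derivative H x) (at x)"
      unfolding H_def by (intro has_derivative_sum has_derivative_scaleR_left partial_derivative that)
    show "(\<Sum>b\<in>Basis. iter_dd f [b] z *\<^sub>R b) = g z" if "z \<in> S" for z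
      unfolding iter_dd_singleton[OF g[OF that]] by (rule euclidean_representation)
  qed
  have H_blinfun: "blinfun_apply (Blinfun (H x)) = H x" if "x \<in> S" for x
    by (rule bounded_linear_Blinfun_apply[OF has_derivative_bounded_linear[OF H_derivative[OF that]]])
  have "continuous_on S (iter_dd f vs)" for vs
    using smooth unfolding smooth_on_def
    by (intro continuous_at_imp_continuous_on ballI differentiable_imp_continuous_within) blast
  then have "continuous_on S (\<lambda>x. H x h)" for h
    unfolding H_def by (intro continuous_intros)
  then have "continuous_on S (\<lambda>x. blinfun_apply (Blinfun (H x)) h)" for h
    by (rule continuous_on_eq) (simp add: H_blinfun)
  then have "continuous_on S (\<lambda>x. Blinfun (H x))" by (rule continuous_on_blinfun_componentwise)
  then show ?thesis
    unfolding continuously_differentiable_on_def using H_derivative H_blinfun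
    by (intro exI[of _ "\<lambda>x. Blinfun (H x)"]) simp
qed

lemma bounded_linear_axis: "bounded_linear (axis i :: 'a::euclidean_space \<Rightarrow> 'a^'n)"
  by (intro linear_conv_bounded_linear[THEN iffD1] linearI) (simp_all add: vec_eq_iff axis_def)

lemma vec_lambda_eq_sum_axis: "(\<chi> i. f i) = (\<Sum>i\<in>UNIV. axis i (f i))"
  by (simp add: vec_eq_iff axis_def)

lemma force_multi_eq_sum_axis:
  fixes Q :: "real^'d^'n"
  shows "force_multi gU gG Q =
    (\<Sum>i\<in>UNIV. axis i (gU (Q $ i)) + (\<Sum>j\<in>UNIV - {i}. axis i (gG (Q $ i - Q $ j))))"
proof -
  have linear: "linear (axis i :: real^'d \<Rightarrow> (real^'d)^'n)" for i :: 'n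
    by (rule bounded_linear.linear[OF bounded_linear_axis])
  show ?thesis
    unfolding force_multi_def vec_lambda_eq_sum_axis
    by (simp add: linear_add[OF linear] linear_sum[OF linear])
qed

lemma open_coll_free: "open (coll_free :: (real^'d^'n) set)"
proof -
  have "(coll_free :: (real^'d^'n) set) = (\<Inter>i. \<Inter>j\<in>-{i}. {Q. Q $ i \<noteq> Q $ j})"
    by (auto simp: coll_free_def)
  moreover have "open \<dots>" by (intro open_INT ballI open_Collect_neq continuous_intros) auto
  ultimately show ?thesis by simp
qed

lemma force_multi_continuously_differentiable:
  fixes gU gG :: "real^'d \<Rightarrow> real^'d"
  assumes gU: "continuously_differentiable_on UNIV gU"
    and gG: "continuously_differentiable_on (- {0}) gG"
  shows "continuously_differentiable_on (coll_free :: (real^'d^'n) set) (force_multi gU gG)"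
proof -
  have "continuously_differentiable_on coll_free (\<lambda>Q::real^'d^'n. axis i (gU (Q $ i)))" for i :: 'n
    by (rule continuously_differentiable_on_compose_linear[OF gU bounded_linear_axis
        bounded_linear_vec_nth]) simp
  moreover
  have "continuously_differentiable_on coll_free (\<lambda>Q::real^'d^'n. axis i (gG (Q $ i - Q $ j)))"
    if "j \<in> UNIV - {i}" for i j :: 'n
    by (rule continuously_differentiable_on_compose_linear[OF gG bounded_linear_axis])
       (use that in \<open>auto intro!: bounded_linear_sub bounded_linear_vec_nth simp: coll_free_def\<close>)
  ultimately show ?thesis
    unfolding force_multi_eq_sum_axis
    by (intro continuously_differentiable_on_sum continuously_differentiable_on_add)
qed

abbreviation locally_lipschitz_on :: "'a::metric_space set \<Rightarrow> ('a \<Rightarrow> 'b::metric_space) \<Rightarrow> bool" where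
  "locally_lipschitz_on S F \<equiv> local_lipschitz (UNIV :: real set) S (\<lambda>_. F)"

lemma continuously_differentiable_on_imp_locally_lipschitz_on:
  fixes F :: "'a::euclidean_space \<Rightarrow> 'a"
  assumes "continuously_differentiable_on S F" "open S"
  shows "locally_lipschitz_on S F"
proof -
  obtain F' where F': "\<And>x. x \<in> S \<Longrightarrow> (F has_derivative blinfun_apply (F' x)) (at x)"
      "continuous_on S F'"
    using assms(1) unfolding continuously_differentiable_on_def by blast
  show ?thesis
  proof (rule c1_implies_local_lipschitz[where f' = "\<lambda>(_, x). F' x"])
    show "continuous_on (UNIV \<times> S) (\<lambda>(_, x). F' x)"
      unfolding case_prod_beta
      by (rule continuous_on_compose2[OF F'(2)]) (auto intro: continuous_intros)
  qed (use F' assms(2) in auto)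
qed

lemma locally_lipschitz_on_compact_tube:
  fixes F :: "'a::euclidean_space \<Rightarrow> 'b::metric_space"
  assumes F: "locally_lipschitz_on S F" and S: "open S" and K: "compact K" "K \<subseteq> S"
  obtains r L where "r > 0" "0 \<le> L"
    "\<And>x y. x \<in> K \<Longrightarrow> dist y x \<le> r \<Longrightarrow> dist (F y) (F x) \<le> L * dist y x"
proof -
  obtain r where r: "r > 0" and rS: "(\<Union>x\<in>K. cball x r) \<subseteq> S"
    using compact_subset_open_imp_cball_epsilon_subset[OF K(1) S K(2)] by blast
  let ?X = "{x + y |x y. x \<in> K \<and> y \<in> cball 0 r}"
  have tube: "y \<in> ?X \<longleftrightarrow> (\<exists>x\<in>K. dist y x \<le> r)" for y
  proof
    assume "\<exists>x\<in>K. dist y x \<le> r"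
    then obtain x where "x \<in> K" "y - x \<in> cball 0 r" by (auto simp: dist_norm norm_minus_commute)
    then show "y \<in> ?X" by (intro CollectI exI[of _ x] exI[of _ "y - x"]) simp
  qed (auto intro!: bexI simp: dist_norm)
  have "?X \<subseteq> S" using rS tube by (force simp: dist_commute)
  then have "local_lipschitz {0::real} ?X (\<lambda>_. F)"
    by (rule local_lipschitz_subset[OF F subset_UNIV])
  from local_lipschitz_compact_implies_lipschitz[OF this compact_sums[OF K(1) compact_cball]]
  obtain L where L: "L-lipschitz_on ?X F" by auto
  show thesis
  proof
    show "0 \<le> L" by (rule lipschitz_on_nonneg[OF L])
    show "dist (F y) (F x) \<le> L * dist y x" if "x \<in> K" "dist y x \<le> r" for x y
    proof (rule lipschitz_onD[OF L])
      show "y \<in> ?X" "x \<in> ?X" unfolding tube using that r by (auto intro: bexI[of _ x])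
    qed
  qed (rule r)
qed

section \<open>Pathwise stability\<close>

lemma gronwall:
  fixes u :: "real \<Rightarrow> real"
  assumes cont: "continuous_on {0..T} u" and b: "b \<ge> 0"
    and integral_ineq: "\<And>t. t \<in> {0..T} \<Longrightarrow> u t \<le> a + b * integral {0..t} u" and t: "t \<in> {0..T}"
  shows "u t \<le> a * exp (b * t)"
proof -
  define I where "I = (\<lambda>t. a + b * integral {0..t} u)"
  let ?J = "\<lambda>t. I t * exp (- (b * t))"
  have I_derivative: "(I has_real_derivative b * u s) (at s within {0..t})" if "s \<in> {0..t}" for s
  proof -
    have "((\<lambda>t. integral {0..t} u) has_real_derivative u s) (at s within {0..t})"
      using t that by (intro integral_has_real_derivative continuous_on_subset[OF cont]) auto
    then show ?thesis unfolding I_def by (auto intro!: derivative_eq_intros)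
  qed
  have "(?J has_derivative (*) ((b * u s - b * I s) * exp (- (b * s)))) (at s within {0..t})"
    if "0 \<le> s" "s \<le> t" for s
  proof -
    have "((\<lambda>t. exp (- (b * t))) has_real_derivative - b * exp (- (b * s))) (at s within {0..t})"
      by (auto intro!: derivative_eq_intros)
    from DERIV_mult[OF I_derivative this] that show ?thesis
      unfolding has_field_derivative_def by (simp add: algebra_simps)
  qed
  from mvt_very_simple[OF _ this] t obtain s where s: "s \<in> {0..t}"
    and diff: "?J t - ?J 0 = (b * u s - b * I s) * exp (- (b * s)) * (t - 0)" by auto
  have "u s \<le> I s" unfolding I_def by (rule integral_ineq) (use s t in auto)
  then have "(b * u s - b * I s) * exp (- (b * s)) * (t - 0) \<le> 0"
    using b t by (intro mult_nonpos_nonneg) (auto intro: mult_left_mono)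
  then have "?J t \<le> a" using diff by (simp add: I_def)
  then have "I t \<le> a * exp (b * t)" by (simp add: exp_minus field_simps)
  then show ?thesis using integral_ineq[OF t] by (simp add: I_def)
qed

lemma continuity_method:
  fixes u :: "real \<Rightarrow> real"
  assumes cont: "continuous_on {0..T} u" and init: "u 0 < \<rho>"
    and improve: "\<And>s. s \<in> {0..T} \<Longrightarrow> (\<And>r. r \<in> {0..s} \<Longrightarrow> u r \<le> \<rho>) \<Longrightarrow> u s < \<rho>"
    and t: "t \<in> {0..T}"
  shows "u t < \<rho>"
proof (rule ccontr)
  assume "\<not> u t < \<rho>"
  let ?A = "{s \<in> {0..T}. \<rho> \<le> u s}"
  have "closed ?A"
    using continuous_closed_preimage[OF cont closed_atLeastAtMost closed_atLeast[of \<rho>]]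
    by (simp add: vimage_def Int_def)
  then have "compact ?A"
    by (auto simp: compact_eq_bounded_closed
        intro: bounded_subset[OF bounded_closed_interval[of 0 T]])
  moreover have "t \<in> ?A" using \<open>\<not> u t < \<rho>\<close> t by auto
  ultimately obtain s where s: "s \<in> ?A" and first: "\<And>s'. s' \<in> ?A \<Longrightarrow> s \<le> s'"
    using compact_attains_inf[of ?A] by blast
  obtain x where x: "0 \<le> x" "x \<le> s" "u x = \<rho>"
    using IVT'[of u 0 \<rho> s] init s continuous_on_subset[OF cont, of "{0..s}"] by auto
  then have "x = s" using first[of x] s by auto
  moreover have "u r < \<rho>" if "r \<in> {0..<s}" for r
    using first[of r] that s by (cases "u r < \<rho>") auto
  ultimately have "u r \<le> \<rho>" if "r \<in> {0..s}" for r
    using that x by (cases "r = s") (auto intro: less_imp_le)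
  then have "u s < \<rho>" using improve s by blast
  then show False using s by simp
qed

definition path_sol :: "('v::euclidean_space \<Rightarrow> 'v) \<Rightarrow> ('v \<Rightarrow> 'v) \<Rightarrow> 'v set
    \<Rightarrow> (real \<Rightarrow> 'v) \<Rightarrow> 'v \<Rightarrow> 'v \<Rightarrow> (real \<Rightarrow> 'v) \<Rightarrow> (real \<Rightarrow> 'v) \<Rightarrow> bool" where
  "path_sol vel F S w q0 p0 q p \<longleftrightarrow> continuous_on {0..} q \<and> continuous_on {0..} p \<and>
     (\<forall>t\<ge>0. q t \<in> S \<and> q t = q0 + integral {0..t} (\<lambda>s. vel (p s))
        \<and> p t = p0 + integral {0..t} (\<lambda>s. - vel (p s) - F (q s)) + sqrt 2 *\<^sub>R w t)"

lemma solves_imp_AE_path_sol: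
  assumes "solves M vel F S W q0 p0 q p"
  shows "AE \<omega> in M. path_sol vel F S (\<lambda>t. W t \<omega>) q0 p0 (\<lambda>t. q t \<omega>) (\<lambda>t. p t \<omega>)"
proof -
  have "AE \<omega> in M. \<forall>t\<ge>0. q t \<omega> \<in> S \<and> q t \<omega> = q0 + integral {0..t} (\<lambda>s. vel (p s \<omega>))
      \<and> p t \<omega> = p0 + integral {0..t} (\<lambda>s. - vel (p s \<omega>) - F (q s \<omega>)) + sqrt 2 *\<^sub>R W t \<omega>"
    using assms unfolding solves_def by blast
  then show ?thesis
    using AE_space by eventually_elim (use assms in \<open>unfold solves_def path_sol_def, blast\<close>)
qed

lemma
  assumes "path_sol vel F S w q0 p0 q p"
  shows path_sol_continuous: "continuous_on {0..} q" "continuous_on {0..} p"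
    and path_sol_in_domain: "0 \<le> t \<Longrightarrow> q t \<in> S"
    and path_sol_position: "0 \<le> t \<Longrightarrow> q t = q0 + integral {0..t} (\<lambda>s. vel (p s))"
    and path_sol_momentum:
        "0 \<le> t \<Longrightarrow> p t = p0 + integral {0..t} (\<lambda>s. - vel (p s) - F (q s)) + sqrt 2 *\<^sub>R w t"
  using assms unfolding path_sol_def by blast+

lemma path_sol_continuous_on_Icc:
  assumes sol: "path_sol vel F S w q0 p0 q p"
    and vel: "continuous_on UNIV vel" and F: "continuous_on S F"
  shows "continuous_on {0..t} q" "continuous_on {0..t} p"
    and "continuous_on {0..t} (\<lambda>s. vel (p s))" "continuous_on {0..t} (\<lambda>s. F (q s))"
proof -
  show q: "continuous_on {0..t} q" and p: "continuous_on {0..t} p"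
    using path_sol_continuous[OF sol] by (auto elim: continuous_on_subset)
  show "continuous_on {0..t} (\<lambda>s. vel (p s))" "continuous_on {0..t} (\<lambda>s. F (q s))"
    using path_sol_in_domain[OF sol]
    by (auto intro!: continuous_on_compose2[OF vel p] continuous_on_compose2[OF F q])
qed

lemma path_sol_diff_le_integral:
  assumes sol: "path_sol vel F S w q0 p0 q p" and sol': "path_sol vel' F S w q0 p0 q' p'"
    and vel: "continuous_on UNIV vel" "continuous_on UNIV vel'" and F: "continuous_on S F"
    and t: "0 \<le> t"
  shows "norm (q' t - q t) + norm (p' t - p t)
    \<le> integral {0..t} (\<lambda>s. 2 * norm (vel' (p' s) - vel (p s)) + norm (F (q' s) - F (q s)))"
proof -
  note cont = path_sol_continuous_on_Icc(3,4)[OF sol vel(1) F]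
    path_sol_continuous_on_Icc(3,4)[OF sol' vel(2) F]
  let ?dv = "\<lambda>s. norm (vel' (p' s) - vel (p s))" and ?dF = "\<lambda>s. norm (F (q' s) - F (q s))"
  have "q' t - q t = integral {0..t} (\<lambda>s. vel' (p' s) - vel (p s))"
    unfolding path_sol_position[OF sol t] path_sol_position[OF sol' t]
    by (subst integral_diff) (auto intro!: integrable_continuous_real cont)
  also have "norm \<dots> \<le> integral {0..t} ?dv"
    by (intro integral_norm_bound_integral integrable_continuous_real continuous_intros cont) auto
  finally have dq: "norm (q' t - q t) \<le> integral {0..t} ?dv" .
  have "p' t - p t = integral {0..t} (\<lambda>s. (- vel' (p' s) - F (q' s)) - (- vel (p s) - F (q s)))"
    by (subst path_sol_momentum[OF sol t], subst path_sol_momentum[OF sol' t], subst integral_diff)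
      (auto intro!: integrable_continuous_real continuous_intros cont)
  also have "norm \<dots> \<le> integral {0..t} (\<lambda>s. ?dv s + ?dF s)"
  proof (intro integral_norm_bound_integral integrable_continuous_real continuous_intros cont)
    show "norm ((- vel' (p' s) - F (q' s)) - (- vel (p s) - F (q s))) \<le> ?dv s + ?dF s" for s
      using norm_triangle_ineq4[of "- (vel' (p' s) - vel (p s))" "F (q' s) - F (q s)"]
      by (simp add: algebra_simps norm_minus_commute)
  qed
  finally have dp: "norm (p' t - p t) \<le> integral {0..t} (\<lambda>s. ?dv s + ?dF s)" .
  have "integral {0..t} (\<lambda>s. ?dv s + (?dv s + ?dF s))
      = integral {0..t} ?dv + integral {0..t} (\<lambda>s. ?dv s + ?dF s)"
    by (intro integral_add integrable_continuous_real continuous_intros cont)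
  then show ?thesis using dq dp unfolding mult_2 add.assoc by linarith
qed

lemma path_sol_diff_le:
  assumes sol: "path_sol vel F S w q0 p0 q p" and sol': "path_sol vel' F S w q0 p0 q' p'"
    and vel: "continuous_on UNIV vel" and vel': "1-lipschitz_on UNIV vel'" and F: "continuous_on S F"
    and c: "\<And>s. s \<in> {0..t} \<Longrightarrow> dist (vel' (p s)) (vel (p s)) \<le> c"
    and L: "0 \<le> L" "\<And>s. s \<in> {0..t} \<Longrightarrow> dist (F (q' s)) (F (q s)) \<le> L * dist (q' s) (q s)"
    and t: "0 \<le> t"
  shows "norm (q' t - q t) + norm (p' t - p t) \<le> 2 * c * t * exp ((2 + L) * t)"
proof (rule gronwall)
  let ?u = "\<lambda>t. norm (q' t - q t) + norm (p' t - p t)"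
  note cont_vel' = lipschitz_on_continuous_on[OF vel']
  note cont = path_sol_continuous_on_Icc[OF sol vel F] path_sol_continuous_on_Icc[OF sol' cont_vel' F]
  show "continuous_on {0..a} ?u" for a by (intro continuous_intros cont)
  show "?u s \<le> 2 * c * t + (2 + L) * integral {0..s} ?u" if s: "s \<in> {0..t}" for s
  proof -
    have "?u s \<le> integral {0..s} (\<lambda>r. 2 * norm (vel' (p' r) - vel (p r)) + norm (F (q' r) - F (q r)))"
      by (rule path_sol_diff_le_integral[OF sol sol' vel cont_vel' F]) (use s in simp)
    also have "\<dots> \<le> integral {0..s} (\<lambda>r. 2 * c + (2 + L) * ?u r)"
    proof (intro integral_le integrable_continuous_real continuous_intros cont)
      fix r assume "r \<in> {0..s}"
      then have r: "r \<in> {0..t}" using s by auto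
      have "dist (vel' (p' r)) (vel (p r))
          \<le> dist (vel' (p' r)) (vel' (p r)) + dist (vel' (p r)) (vel (p r))"
        by (rule dist_triangle)
      also have "\<dots> \<le> norm (p' r - p r) + c"
        using lipschitz_onD[OF vel', of "p' r" "p r"] c[OF r] by (simp add: dist_norm)
      finally show "2 * norm (vel' (p' r) - vel (p r)) + norm (F (q' r) - F (q r))
          \<le> 2 * c + (2 + L) * ?u r"
        using L(2)[OF r] mult_nonneg_nonneg[OF L(1) norm_ge_zero[of "p' r - p r"]]
          norm_ge_zero[of "q' r - q r"]
        unfolding dist_norm distrib_left distrib_right by linarith
    qed
    also have "\<dots> = 2 * c * s + (2 + L) * integral {0..s} ?u"
      using s by (subst integral_add) (auto intro!: integrable_continuous_real continuous_intros cont)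
    also have "2 * c * s \<le> 2 * c * t"
      using s order_trans[OF zero_le_dist c[of 0]] by (intro mult_left_mono) auto
    finally show ?thesis by simp
  qed
qed (use L t in auto)

lemma path_sol_close:
  assumes sol: "path_sol vel F S w q0 p0 q p" and sol': "path_sol vel' F S w q0 p0 q' p'"
    and vel: "continuous_on UNIV vel" and vel': "1-lipschitz_on UNIV vel'" and F: "continuous_on S F"
    and c: "\<And>t. t \<in> {0..T} \<Longrightarrow> dist (vel' (p t)) (vel (p t)) \<le> c"
    and L: "0 \<le> L" "\<And>t y. t \<in> {0..T} \<Longrightarrow> dist y (q t) \<le> \<rho> \<Longrightarrow> dist (F y) (F (q t)) \<le> L * dist y (q t)"
    and small: "2 * c * T * exp ((2 + L) * T) < \<rho>" and t: "t \<in> {0..T}"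
  shows "norm (q' t - q t) + norm (p' t - p t) < \<rho>" (is "?u t < \<rho>")
proof (rule continuity_method[OF _ _ _ t])
  have c_nonneg: "0 \<le> c" using order_trans[OF zero_le_dist c[OF t]] .
  have \<rho>: "0 < \<rho>" by (rule le_less_trans[OF _ small]) (use c_nonneg t in auto)
  show "continuous_on {0..T} ?u"
    by (intro continuous_intros path_sol_continuous_on_Icc[OF sol vel F]
        path_sol_continuous_on_Icc[OF sol' lipschitz_on_continuous_on[OF vel'] F])
  show "?u 0 < \<rho>"
    using path_sol_position[OF sol, of 0] path_sol_momentum[OF sol, of 0]
      path_sol_position[OF sol', of 0] path_sol_momentum[OF sol', of 0] \<rho> by simp
  show "?u s < \<rho>" if s: "s \<in> {0..T}" and before: "\<And>r. r \<in> {0..s} \<Longrightarrow> ?u r \<le> \<rho>" for s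
  proof -
    have "?u s \<le> 2 * c * s * exp ((2 + L) * s)"
    proof (rule path_sol_diff_le[OF sol sol' vel vel' F _ L(1)])
      fix r assume r: "r \<in> {0..s}"
      then show "dist (vel' (p r)) (vel (p r)) \<le> c" using s by (intro c) auto
      have "dist (q' r) (q r) \<le> \<rho>"
        using before[OF r] norm_ge_zero[of "p' r - p r"] unfolding dist_norm by linarith
      then show "dist (F (q' r)) (F (q r)) \<le> L * dist (q' r) (q r)" using r s by (intro L(2)) auto
    qed (use s in auto)
    also have "\<dots> \<le> 2 * c * T * exp ((2 + L) * T)"
      using s L(1) c_nonneg by (intro mult_mono) auto
    finally show ?thesis using small by simp
  qed
qed

lemma path_sol_stable:
  fixes q p :: "real \<Rightarrow> 'v::euclidean_space"
  assumes S: "open S" and F: "locally_lipschitz_on S F" and vel: "continuous_on UNIV vel"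
    and sol: "path_sol vel F S w q0 p0 q p" and T: "0 \<le> T" and \<xi>: "0 < \<xi>"
  obtains c where "0 < c"
    "\<And>vel' q' p' t. 1-lipschitz_on UNIV vel' \<Longrightarrow> path_sol vel' F S w q0 p0 q' p' \<Longrightarrow>
       (\<And>s. s \<in> {0..T} \<Longrightarrow> dist (vel' (p s)) (vel (p s)) \<le> c) \<Longrightarrow> t \<in> {0..T} \<Longrightarrow>
       norm (q' t - q t) + norm (p' t - p t) < \<xi>"
proof -
  have cont_F: "continuous_on S F" by (rule local_lipschitz_continuous_on[OF F UNIV_I])
  obtain r L where r: "r > 0" and L: "0 \<le> L"
    and lip: "\<And>x y. x \<in> q ` {0..T} \<Longrightarrow> dist y x \<le> r \<Longrightarrow> dist (F y) (F x) \<le> L * dist y x"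
    by (rule locally_lipschitz_on_compact_tube[OF F S, of "q ` {0..T}"])
      (use path_sol_in_domain[OF sol] in \<open>auto intro!: compact_continuous_image
        path_sol_continuous_on_Icc[OF sol vel cont_F]\<close>)
  define D where "D = 2 * T * exp ((2 + L) * T)"
  define \<rho> where "\<rho> = min r \<xi>"
  have "0 \<le> D" using T by (simp add: D_def)
  have "0 < \<rho>" using r \<xi> by (simp add: \<rho>_def)
  show thesis
  proof
    show "0 < \<rho> / (D + 1)" using \<open>0 \<le> D\<close> \<open>0 < \<rho>\<close> by simp
    have small: "2 * (\<rho> / (D + 1)) * T * exp ((2 + L) * T) < \<rho>"
      using \<open>0 \<le> D\<close> \<open>0 < \<rho>\<close> by (simp add: D_def[symmetric] mult_ac) (simp add: D_def field_simps)
    fix vel' q' p' t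
    assume vel': "1-lipschitz_on UNIV vel'" and sol': "path_sol vel' F S w q0 p0 q' p'"
      and close: "\<And>s. s \<in> {0..T} \<Longrightarrow> dist (vel' (p s)) (vel (p s)) \<le> \<rho> / (D + 1)" and t: "t \<in> {0..T}"
    have "norm (q' t - q t) + norm (p' t - p t) < \<rho>"
      by (rule path_sol_close[OF sol sol' vel vel' cont_F close L lip small t]) (auto simp: \<rho>_def)
    then show "norm (q' t - q t) + norm (p' t - p t) < \<xi>" by (simp add: \<rho>_def)
  qed
qed

theorem path_sol_uniform_limit:
  fixes q p :: "real \<Rightarrow> 'v::euclidean_space"
  assumes S: "open S" and F: "locally_lipschitz_on S F" and vel: "continuous_on UNIV vel"
    and sol: "path_sol vel F S w q0 p0 q p"
    and vel': "\<forall>\<^sub>F i in \<F>. 1-lipschitz_on UNIV (vel' i)"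
    and lim: "\<And>R. uniform_limit (cball 0 R) vel' vel \<F>"
    and sol': "\<forall>\<^sub>F i in \<F>. path_sol (vel' i) F S w q0 p0 (q' i) (p' i)"
  shows "uniform_limit {0..T} (\<lambda>i t. norm (q' i t - q t) + norm (p' i t - p t)) (\<lambda>_. 0) \<F>"
proof (cases "0 \<le> T")
  case True
  have "continuous_on {0..T} p"
    by (rule path_sol_continuous_on_Icc[OF sol vel local_lipschitz_continuous_on[OF F UNIV_I]])
  then have "bounded (p ` {0..T})" by (intro compact_imp_bounded compact_continuous_image compact_Icc)
  then obtain R where "\<forall>x\<in>p ` {0..T}. norm x \<le> R" unfolding bounded_iff ..
  then have R: "p s \<in> cball 0 R" if "s \<in> {0..T}" for s using that by auto
  show ?thesis
  proof (rule uniform_limitI)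
    fix \<xi> :: real assume "0 < \<xi>"
    then obtain c where "0 < c" and stable: "\<And>vel' q' p' t. 1-lipschitz_on UNIV vel' \<Longrightarrow>
        path_sol vel' F S w q0 p0 q' p' \<Longrightarrow>
        (\<And>s. s \<in> {0..T} \<Longrightarrow> dist (vel' (p s)) (vel (p s)) \<le> c) \<Longrightarrow> t \<in> {0..T} \<Longrightarrow>
        norm (q' t - q t) + norm (p' t - p t) < \<xi>"
      using path_sol_stable[OF S F vel sol True] by blast
    have "\<forall>\<^sub>F i in \<F>. \<forall>x\<in>cball 0 R. dist (vel' i x) (vel x) < c"
      by (rule uniform_limitD[OF lim \<open>0 < c\<close>])
    then show "\<forall>\<^sub>F i in \<F>. \<forall>t\<in>{0..T}. dist (norm (q' i t - q t) + norm (p' i t - p t)) 0 < \<xi>"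
      using vel' sol'
      by eventually_elim (use stable R in \<open>auto simp: less_imp_le\<close>)
  qed
qed simp

section \<open>Relativistic velocities\<close>

text \<open>The properties shared by the classical and the relativistic velocity \<open>v\<close> and kinetic energy
  \<open>K\<close>, uniformly in \<open>\<epsilon>\<close>.\<close>

locale kinetic_energy =
  fixes v :: "'v::euclidean_space \<Rightarrow> 'v" and K :: "'v \<Rightarrow> real"
  assumes GDERIV_K: "GDERIV K y :> v y"
    and v_lipschitz: "1-lipschitz_on UNIV v"
    and v_parallel: "\<exists>c. 0 \<le> c \<and> c \<le> 1 \<and> v y = c *\<^sub>R y"
    and K_nonneg: "0 \<le> K y"
    and norm_le_K: "norm y \<le> K y + 1"
    and norm_v_sq_le: "(norm (v y))\<^sup>2 \<le> 2 * K y"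
    and K_le_norm_sq: "K y \<le> (norm y)\<^sup>2"

lemma dist_sgn_le:
  fixes a b :: "'a::real_inner"
  assumes "1 \<le> norm a" "1 \<le> norm b"
  shows "dist (sgn a) (sgn b) \<le> dist a b"
proof (rule power2_le_imp_le)
  let ?N = "norm a * norm b"
  have cosine: "(dist x y)\<^sup>2 = (norm x)\<^sup>2 + (norm y)\<^sup>2 - 2 * (x \<bullet> y)" for x y :: 'a
    by (simp add: dist_norm power2_norm_eq_inner inner_diff inner_commute)
  have nonzero: "a \<noteq> 0" "b \<noteq> 0" using assms by auto
  have "1 \<le> ?N" using mult_mono[OF assms] by simp
  then have "(dist (sgn a) (sgn b))\<^sup>2 \<le> ?N * (dist (sgn a) (sgn b))\<^sup>2"
    by (simp add: mult_le_cancel_right1)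
  also have "\<dots> = (dist a b)\<^sup>2 - (norm a - norm b)\<^sup>2"
    using nonzero by (simp add: cosine norm_sgn sgn_div_norm) (simp add: power2_eq_square field_simps)
  also have "\<dots> \<le> (dist a b)\<^sup>2" by simp
  finally show "(dist (sgn a) (sgn b))\<^sup>2 \<le> (dist a b)\<^sup>2" .
qed simp

text \<open>Up to a factor \<open>\<surd>\<epsilon>\<close>, the relativistic velocity is a component of the radial projection of
  \<open>(1, \<surd>\<epsilon> p)\<close> to the unit ball.\<close>

lemma rel_vel_lipschitz:
  assumes "0 \<le> \<epsilon>"
  shows "1-lipschitz_on UNIV (rel_vel \<epsilon>)"
proof (cases "\<epsilon> = 0")
  case False
  show ?thesis
  proof (rule lipschitz_onI)
    fix x y
    let ?lift = "\<lambda>p. (1 :: real, sqrt \<epsilon> *\<^sub>R p)"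
    have norm_lift: "norm (?lift p) = sqrt (1 + \<epsilon> * (norm p)\<^sup>2)" for p
      using assms by (simp add: norm_Pair power_mult_distrib)
    have snd_sgn: "snd (sgn (?lift p)) = sqrt \<epsilon> *\<^sub>R rel_vel \<epsilon> p" for p
      by (simp add: sgn_div_norm norm_lift rel_vel_def divide_inverse mult.commute)
    have "sqrt \<epsilon> * dist (rel_vel \<epsilon> x) (rel_vel \<epsilon> y)
        = dist (snd (sgn (?lift x))) (snd (sgn (?lift y)))"
      using assms by (simp add: snd_sgn dist_norm flip: scaleR_diff_right)
    also have "\<dots> \<le> dist (sgn (?lift x)) (sgn (?lift y))" by (rule dist_snd_le)
    also have "\<dots> \<le> dist (?lift x) (?lift y)"
      using assms by (intro dist_sgn_le) (auto simp: norm_lift)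
    also have "\<dots> = sqrt \<epsilon> * dist x y"
      using assms by (simp add: dist_Pair_Pair dist_norm flip: scaleR_diff_right)
    finally show "dist (rel_vel \<epsilon> x) (rel_vel \<epsilon> y) \<le> 1 * dist x y"
      using assms False by simp
  qed simp
qed (simp add: rel_vel_def lipschitz_on_id)

lemma rel_vel_zero: "rel_vel 0 = (\<lambda>p. p)"
  by (simp add: rel_vel_def fun_eq_iff)

lemma dist_rel_vel_id_le:
  assumes "0 \<le> \<epsilon>"
  shows "dist (rel_vel \<epsilon> x) x \<le> \<epsilon> * norm x ^ 3"
proof -
  define A where "A = sqrt (1 + \<epsilon> * (norm x)\<^sup>2)"
  have A: "1 \<le> A" "A\<^sup>2 = 1 + \<epsilon> * (norm x)\<^sup>2" using assms by (auto simp: A_def)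
  have "1 - 1 / A \<le> A\<^sup>2 - 1"
  proof -
    have "1 - 1 / A = (A - 1) / A" using A by (simp add: field_simps)
    also have "\<dots> \<le> A - 1" using A by (simp add: divide_le_eq mult_le_cancel_left1)
    also have "\<dots> \<le> A\<^sup>2 - 1" using self_le_power[OF A(1), of 2] by simp
    finally show ?thesis .
  qed
  then have "(1 - 1 / A) * norm x \<le> \<epsilon> * (norm x)\<^sup>2 * norm x" using A by (intro mult_right_mono) auto
  moreover have "x - rel_vel \<epsilon> x = (1 - 1 / A) *\<^sub>R x" by (simp add: rel_vel_def A_def algebra_simps)
  then have "dist (rel_vel \<epsilon> x) x = (1 - 1 / A) * norm x"
    using A by (subst dist_commute) (simp add: dist_norm)
  ultimately show ?thesis by (simp add: power3_eq_cube power2_eq_square mult_ac)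
qed

lemma rel_vel_multi_lipschitz:
  assumes "0 \<le> \<epsilon>"
  shows "1-lipschitz_on UNIV (rel_vel_multi \<epsilon> :: real^'d^'n \<Rightarrow> _)"
proof (rule lipschitz_onI)
  show "dist (rel_vel_multi \<epsilon> x) (rel_vel_multi \<epsilon> y) \<le> 1 * dist x y" for x y :: "real^'d^'n"
    unfolding dist_vec_def[of "rel_vel_multi \<epsilon> x"] dist_vec_def[of x]
    using lipschitz_onD[OF rel_vel_lipschitz[OF assms]]
    by (auto simp: rel_vel_multi_def intro!: L2_set_mono)
qed simp

lemma dist_rel_vel_multi_id_le:
  fixes x :: "real^'d^'n"
  assumes "0 \<le> \<epsilon>"
  shows "dist (rel_vel_multi \<epsilon> x) x \<le> real CARD('n) * (\<epsilon> * norm x ^ 3)"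
proof -
  have "dist (rel_vel_multi \<epsilon> x) x \<le> (\<Sum>i\<in>UNIV. dist (rel_vel \<epsilon> (x $ i)) (x $ i))"
    unfolding dist_vec_def rel_vel_multi_def by (simp add: L2_set_le_sum)
  also have "\<dots> \<le> (\<Sum>i\<in>(UNIV::'n set). \<epsilon> * norm x ^ 3)"
  proof (rule sum_mono)
    fix i
    have "dist (rel_vel \<epsilon> (x $ i)) (x $ i) \<le> \<epsilon> * norm (x $ i) ^ 3"
      by (rule dist_rel_vel_id_le[OF assms])
    also have "\<dots> \<le> \<epsilon> * norm x ^ 3"
      using assms by (intro mult_left_mono power_mono Finite_Cartesian_Product.norm_nth_le) auto
    finally show "dist (rel_vel \<epsilon> (x $ i)) (x $ i) \<le> \<epsilon> * norm x ^ 3" .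
  qed
  finally show ?thesis by simp
qed

lemma uniform_limit_cball_idI:
  fixes v :: "real \<Rightarrow> 'a::real_normed_vector \<Rightarrow> 'a"
  assumes v: "\<And>\<epsilon> x. 0 \<le> \<epsilon> \<Longrightarrow> dist (v \<epsilon> x) x \<le> c * (\<epsilon> * norm x ^ k)"
    and X: "(X \<longlongrightarrow> 0) \<F>" "\<forall>\<^sub>F i in \<F>. 0 \<le> X i" and c: "0 \<le> c"
  shows "uniform_limit (cball 0 R) (\<lambda>i. v (X i)) (\<lambda>x. x) \<F>"
proof (rule metric_uniform_limit_imp_uniform_limit)
  have "((\<lambda>i. c * (X i * R ^ k)) \<longlongrightarrow> c * (0 * R ^ k)) \<F>" by (intro tendsto_intros X)
  then show "uniform_limit (cball 0 R) (\<lambda>i _. c * (X i * R ^ k)) (\<lambda>_. 0) \<F>"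
    by (auto simp: uniform_limit_iff dest: tendstoD)
  show "\<forall>\<^sub>F i in \<F>. \<forall>x\<in>cball 0 R. dist (v (X i) x) x \<le> dist (c * (X i * R ^ k)) 0"
    using X(2)
  proof eventually_elim
    case (elim i)
    have "dist (v (X i) x) x \<le> c * (X i * R ^ k)" if "x \<in> cball 0 R" for x
    proof (rule order_trans[OF v[OF elim]])
      show "c * (X i * norm x ^ k) \<le> c * (X i * R ^ k)"
        using that elim c by (intro mult_left_mono power_mono) auto
    qed
    then show ?case by (force intro: order_trans[OF _ abs_ge_self])
  qed
qed

text \<open>For \<open>\<epsilon> > 0\<close> this is \<open>(\<surd>(1 + \<epsilon>|p|\<^sup>2) - 1) / \<epsilon>\<close>; in the present form \<open>\<epsilon> = 0\<close> gives the
  classical energy \<open>|p|\<^sup>2 / 2\<close>.\<close>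

definition rel_energy :: "real \<Rightarrow> 'v::real_normed_vector \<Rightarrow> real" where
  "rel_energy \<epsilon> p = (norm p)\<^sup>2 / (1 + sqrt (1 + \<epsilon> * (norm p)\<^sup>2))"

lemma
  assumes "0 \<le> \<epsilon>"
  shows rel_energy_nonneg: "0 \<le> rel_energy \<epsilon> p"
    and sqrt_eq_rel_energy: "sqrt (1 + \<epsilon> * (norm p)\<^sup>2) = 1 + \<epsilon> * rel_energy \<epsilon> p"
    and norm_sq_eq_rel_energy: "(norm p)\<^sup>2 = 2 * rel_energy \<epsilon> p + \<epsilon> * (rel_energy \<epsilon> p)\<^sup>2"
proof -
  define A where "A = sqrt (1 + \<epsilon> * (norm p)\<^sup>2)"
  have A: "1 \<le> A" "A\<^sup>2 = 1 + \<epsilon> * (norm p)\<^sup>2" using assms by (auto simp: A_def)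
  have norm_sq: "(norm p)\<^sup>2 = rel_energy \<epsilon> p * (1 + A)"
    using A(1) by (simp add: rel_energy_def flip: A_def)
  show "0 \<le> rel_energy \<epsilon> p" using assms by (simp add: rel_energy_def)
  have "(A - 1) * (1 + A) = \<epsilon> * rel_energy \<epsilon> p * (1 + A)"
    using A(2) norm_sq by (simp add: power2_eq_square algebra_simps)
  then have "A = 1 + \<epsilon> * rel_energy \<epsilon> p" using A(1) by simp
  then show "sqrt (1 + \<epsilon> * (norm p)\<^sup>2) = 1 + \<epsilon> * rel_energy \<epsilon> p"
    and "(norm p)\<^sup>2 = 2 * rel_energy \<epsilon> p + \<epsilon> * (rel_energy \<epsilon> p)\<^sup>2"
    using norm_sq by (simp_all add: A_def power2_eq_square algebra_simps)
qed

lemma GDERIV_rel_energy: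
  fixes p :: "real^'d"
  assumes "0 \<le> \<epsilon>"
  shows "GDERIV (rel_energy \<epsilon>) p :> rel_vel \<epsilon> p"
proof -
  define A where "A = sqrt (1 + \<epsilon> * (p \<bullet> p))"
  have A: "1 \<le> A" "A\<^sup>2 = 1 + \<epsilon> * (p \<bullet> p)" using assms by (auto simp: A_def)
  have "((\<lambda>p. p \<bullet> p / (1 + sqrt (1 + \<epsilon> * (p \<bullet> p)))) has_derivative
      (\<lambda>h. (2 * (h \<bullet> p) * (1 + A) - p \<bullet> p * (\<epsilon> * (h \<bullet> p) / A)) / (1 + A)\<^sup>2)) (at p)"
    using A add_pos_pos[OF zero_less_one less_le_trans[OF zero_less_one A(1)]]
    by (auto intro!: derivative_eq_intros simp: A_def inner_commute power2_eq_square fun_eq_iff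
        divide_simps)
  moreover have "(2 * d * (1 + A) - p \<bullet> p * (\<epsilon> * d / A)) / (1 + A)\<^sup>2 = d / A" for d
  proof -
    have "2 * d * (1 + A) - p \<bullet> p * (\<epsilon> * d / A) = d * (2 * (1 + A) * A - (A\<^sup>2 - 1)) / A"
      using A by (simp add: field_simps)
    also have "2 * (1 + A) * A - (A\<^sup>2 - 1) = (1 + A)\<^sup>2" by (simp add: power2_eq_square algebra_simps)
    finally show ?thesis using A(1) by simp
  qed
  ultimately show ?thesis
    by (simp add: gderiv_def rel_energy_def[abs_def] rel_vel_def power2_norm_eq_inner A_def)
qed

lemma kinetic_energy_rel:
  assumes \<epsilon>: "0 \<le> \<epsilon>" "\<epsilon> \<le> 1"
  shows "kinetic_energy (rel_vel \<epsilon> :: real^'d \<Rightarrow> _) (rel_energy \<epsilon>)"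
proof
  fix y :: "real^'d"
  define K where "K = rel_energy \<epsilon> y"
  have K_nonneg: "0 \<le> K" unfolding K_def by (rule rel_energy_nonneg[OF \<epsilon>(1)])
  note norm_sq = norm_sq_eq_rel_energy[OF \<epsilon>(1), of y, folded K_def]
  have vel: "rel_vel \<epsilon> y = (1 / (1 + \<epsilon> * K)) *\<^sub>R y"
    by (simp add: rel_vel_def sqrt_eq_rel_energy[OF \<epsilon>(1)] K_def)
  have ge1: "1 \<le> 1 + \<epsilon> * K" using \<epsilon> K_nonneg by simp
  show "GDERIV (rel_energy \<epsilon>) y :> rel_vel \<epsilon> y" by (rule GDERIV_rel_energy[OF \<epsilon>(1)])
  show "1-lipschitz_on UNIV (rel_vel \<epsilon> :: real^'d \<Rightarrow> _)" by (rule rel_vel_lipschitz[OF \<epsilon>(1)])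
  show "\<exists>c. 0 \<le> c \<and> c \<le> 1 \<and> rel_vel \<epsilon> y = c *\<^sub>R y"
    using ge1 vel by (intro exI[of _ "1 / (1 + \<epsilon> * K)"]) simp
  show "0 \<le> rel_energy \<epsilon> y" using K_nonneg by (simp add: K_def)
  have "\<epsilon> * K\<^sup>2 \<le> K\<^sup>2" using \<epsilon> by (simp add: mult_left_le_one_le)
  then have "(norm y)\<^sup>2 \<le> (K + 1)\<^sup>2" unfolding norm_sq by (simp add: power2_eq_square algebra_simps)
  then have "norm y \<le> K + 1" by (rule power2_le_imp_le) (use K_nonneg in simp)
  then show "norm y \<le> rel_energy \<epsilon> y + 1" by (simp add: K_def)
  have "K \<le> (norm y)\<^sup>2" unfolding norm_sq using \<epsilon> K_nonneg by simp
  then show "rel_energy \<epsilon> y \<le> (norm y)\<^sup>2" by (simp add: K_def)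
  have "2 * K * (1 + \<epsilon> * K)\<^sup>2 - (norm y)\<^sup>2 = \<epsilon> * K\<^sup>2 * (3 + 2 * \<epsilon> * K)"
    unfolding norm_sq by (simp add: power2_eq_square algebra_simps)
  also have "\<dots> \<ge> 0" using \<epsilon> K_nonneg by simp
  finally have "(norm y)\<^sup>2 / (1 + \<epsilon> * K)\<^sup>2 \<le> 2 * K" using ge1 by (simp add: divide_le_eq)
  then show "(norm (rel_vel \<epsilon> y))\<^sup>2 \<le> 2 * rel_energy \<epsilon> y"
    using ge1 by (simp add: vel power_divide K_def)
qed

section \<open>Confining potentials with a repulsive singularity\<close>

locale confining_repulsive =
  fixes U :: "'v::euclidean_space \<Rightarrow> real" and gradU :: "'v \<Rightarrow> 'v"
    and G :: "'v \<Rightarrow> real" and gradG :: "'v \<Rightarrow> 'v" and A \<beta> \<gamma> :: real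
  assumes GDERIV_U: "GDERIV U q :> gradU q" and GDERIV_G: "q \<noteq> 0 \<Longrightarrow> GDERIV G q :> gradG q"
    and U_ge_1: "1 \<le> U q"
    and A_nonneg: "0 \<le> A" and \<beta>_ge_1: "1 \<le> \<beta>" and \<gamma>_pos: "0 < \<gamma>"
    and norm_le_U: "norm q \<le> A * U q"
    and norm_gradU_le: "norm (gradU q) \<le> A * U q"
    and norm_gradG_le: "q \<noteq> 0 \<Longrightarrow> norm (gradG q) \<le> A * (1 + norm q powr (- \<beta>))"
    and potential_lower_bound: "q \<noteq> 0 \<Longrightarrow> U q / 2 - A \<le> U q + G q"
    and repulsion: "q \<noteq> 0 \<Longrightarrow> \<gamma> * norm q powr (- \<beta>) - A \<le> - (gradG q \<bullet> sgn q)"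

lemma powr_le_one_plus_powr:
  fixes x :: real
  assumes "0 \<le> x" "0 \<le> a" "a \<le> b"
  shows "x powr a \<le> 1 + x powr b"
proof (cases "x \<le> 1")
  case True
  then have "x powr a \<le> 1" using assms powr_mono2[of a x 1] by simp
  then show ?thesis by (simp add: add_increasing2)
next
  case False
  then have "x powr a \<le> x powr b" using assms by (intro powr_mono) auto
  then show ?thesis by simp
qed

lemma powr_minus_absorb:
  fixes a b \<delta> :: real
  assumes ab: "0 \<le> a" "a < b" and \<delta>: "0 < \<delta>"
  obtains C where "0 \<le> C" "\<And>x. 0 < x \<Longrightarrow> x powr (- a) \<le> \<delta> * x powr (- b) + C"
proof
  define r where "r = \<delta> powr (1 / (b - a))"
  have r: "0 < r" "r powr (b - a) = \<delta>" using ab \<delta> by (auto simp: r_def powr_powr)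
  show "x powr (- a) \<le> \<delta> * x powr (- b) + r powr (- a)" if x: "0 < x" for x
  proof (cases "x \<le> r")
    case True
    have "x powr (- a) = x powr (b - a) * x powr (- b)" by (simp flip: powr_add)
    also have "\<dots> \<le> \<delta> * x powr (- b)"
      unfolding r(2)[symmetric] using True ab x by (intro mult_right_mono powr_mono2) auto
    finally show ?thesis by (simp add: add_increasing2)
  next
    case False
    then have "x powr (- a) \<le> r powr (- a)" using r(1) ab by (intro powr_mono2') auto
    then show ?thesis using \<delta> by (simp add: add_increasing)
  qed
qed simp

locale confining_potential =
  fixes U :: "'v::euclidean_space \<Rightarrow> real" and gradU :: "'v \<Rightarrow> 'v" and a1 lam :: real
  assumes U_ge_1: "1 \<le> U q"
    and a1_pos: "0 < a1" and lam_ge_1: "1 \<le> lam"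
    and U_lower: "(1 / a1) * norm q powr (lam + 1) - a1 \<le> U q"
    and norm_gradU_le: "norm (gradU q) \<le> a1 * (1 + norm q powr lam)"
begin

definition growth_const :: real where
  "growth_const = 1 + a1 * (1 + a1)"

lemma growth_const_pos: "0 < growth_const"
  using a1_pos by (simp add: growth_const_def add_pos_pos)

lemma norm_powr_le_U:
  assumes "0 \<le> e" "e \<le> lam + 1"
  shows "norm q powr e \<le> growth_const * U q"
proof -
  have "norm q powr e \<le> 1 + norm q powr (lam + 1)" by (rule powr_le_one_plus_powr) (use assms in auto)
  also have "norm q powr (lam + 1) \<le> a1 * (U q + a1)"
    using U_lower[of q] a1_pos by (simp add: field_simps)
  also have "1 + a1 * (U q + a1) \<le> U q + a1 * (U q + a1 * U q)"
    using U_ge_1[of q] a1_pos by (intro add_mono mult_left_mono) auto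
  finally show ?thesis by (simp add: growth_const_def algebra_simps)
qed

lemma norm_le_U: "norm q \<le> growth_const * U q"
  using norm_powr_le_U[of 1 q] lam_ge_1 by (cases "q = 0") auto

lemma norm_gradU_le_U: "norm (gradU q) \<le> a1 * (1 + growth_const) * U q"
proof -
  have "1 + norm q powr lam \<le> U q + growth_const * U q"
    using norm_powr_le_U[of lam q] lam_ge_1 U_ge_1[of q] by (intro add_mono) auto
  then have "a1 * (1 + norm q powr lam) \<le> a1 * (U q + growth_const * U q)"
    using a1_pos by (intro mult_left_mono) auto
  then show ?thesis using norm_gradU_le[of q] by (simp add: algebra_simps)
qed

lemma linear_le_half_U: "a * norm q \<le> U q / 2 + growth_const * a\<^sup>2 / 2"
proof -
  let ?c = growth_const
  have "0 \<le> (norm q - ?c * a)\<^sup>2 / (2 * ?c)" using growth_const_pos by simp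
  then have "a * norm q \<le> (norm q)\<^sup>2 / (2 * ?c) + ?c * a\<^sup>2 / 2"
    using growth_const_pos by (simp add: power2_eq_square field_simps)
  moreover have "(norm q)\<^sup>2 \<le> ?c * U q"
    using norm_powr_le_U[of 2 q] lam_ge_1 by (cases "q = 0") auto
  then have "(norm q)\<^sup>2 / (2 * ?c) \<le> U q / 2"
    using growth_const_pos by (simp add: divide_le_eq mult.commute)
  ultimately show ?thesis by simp
qed

end

locale repulsive_potential =
  fixes G :: "'v::euclidean_space \<Rightarrow> real" and gradG :: "'v \<Rightarrow> 'v" and a1 \<beta>1 \<beta>2 a4 a5 a6 :: real
  assumes a1_pos: "0 < a1" and \<beta>1_nonneg: "0 \<le> \<beta>1" and \<beta>2: "0 \<le> \<beta>2" "\<beta>2 < \<beta>1" and a4_pos: "0 < a4"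
    and G_sing: "filterlim G at_top (at 0)"
    and G_bound: "q \<noteq> 0 \<Longrightarrow> \<bar>G q\<bar> \<le> a1 * (1 + norm q + norm q powr (- \<beta>1))"
    and gradG_asymp: "q \<noteq> 0 \<Longrightarrow>
        norm (gradG q + (a4 / norm q powr (\<beta>1 + 1)) *\<^sub>R q + (a5 / norm q powr (\<beta>2 + 1)) *\<^sub>R q) \<le> a6"
begin

lemma G_lower_bound:
  obtains C where "0 \<le> C" "\<And>q. q \<noteq> 0 \<Longrightarrow> - (C + a1 * norm q) \<le> G q"
proof -
  have "eventually (\<lambda>q. 0 \<le> G q) (at 0)" using G_sing unfolding filterlim_at_top by blast
  then obtain r where r: "r > 0" "\<And>q. q \<noteq> 0 \<Longrightarrow> dist q 0 < r \<Longrightarrow> 0 \<le> G q"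
    unfolding eventually_at by auto
  show thesis
  proof
    fix q :: 'v assume q: "q \<noteq> 0"
    show "- (a1 * (1 + r powr (- \<beta>1)) + a1 * norm q) \<le> G q"
    proof (cases "norm q < r")
      case True
      have "0 \<le> a1 * (1 + r powr (- \<beta>1)) + a1 * norm q" using a1_pos by (intro add_nonneg_nonneg) auto
      with True r(2)[OF q] show ?thesis by simp
    next
      case False
      then have "norm q powr (- \<beta>1) \<le> r powr (- \<beta>1)" using r(1) \<beta>1_nonneg by (intro powr_mono2') auto
      then have "a1 * (1 + norm q + norm q powr (- \<beta>1)) \<le> a1 * (1 + norm q + r powr (- \<beta>1))"
        using a1_pos by (intro mult_left_mono) auto
      then show ?thesis using G_bound[OF q] by (simp add: algebra_simps)
    qed
  qed (use a1_pos in simp)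
qed

lemma radial_repulsion:
  obtains C where "0 \<le> C" "\<And>q. q \<noteq> 0 \<Longrightarrow> a4 / 2 * norm q powr (- \<beta>1) - C \<le> - (gradG q \<bullet> sgn q)"
proof -
  define \<delta> where "\<delta> = a4 / (2 * (\<bar>a5\<bar> + 1))"
  have \<delta>: "0 < \<delta>" "\<bar>a5\<bar> * \<delta> \<le> a4 / 2" using a4_pos by (auto simp: \<delta>_def field_simps)
  obtain C where C: "0 \<le> C" "\<And>x. 0 < x \<Longrightarrow> x powr (- \<beta>2) \<le> \<delta> * x powr (- \<beta>1) + C"
    using powr_minus_absorb[OF \<beta>2 \<delta>(1)] by blast
  show thesis
  proof
    show "0 \<le> \<bar>a6\<bar> + \<bar>a5\<bar> * C" using C(1) by simp
    fix q :: 'v assume q: "q \<noteq> 0"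
    let ?x1 = "norm q powr (- \<beta>1)" and ?x2 = "norm q powr (- \<beta>2)"
    let ?R = "gradG q + (a4 / norm q powr (\<beta>1 + 1)) *\<^sub>R q + (a5 / norm q powr (\<beta>2 + 1)) *\<^sub>R q"
    have "c / norm q powr (b + 1) * (q \<bullet> sgn q) = c * norm q powr (- b)" for b c
      using q by (simp add: sgn_div_norm powr_add powr_minus field_simps flip: power2_norm_eq_inner)
        (simp add: power2_eq_square)
    then have "?R \<bullet> sgn q = gradG q \<bullet> sgn q + a4 * ?x1 + a5 * ?x2"
      by (simp add: inner_add_left)
    moreover have "?R \<bullet> sgn q \<le> \<bar>a6\<bar>"
      using norm_cauchy_schwarz[of ?R "sgn q"] gradG_asymp[OF q] q by (simp add: norm_sgn)
    moreover have "- (a5 * ?x2) \<le> a4 / 2 * ?x1 + \<bar>a5\<bar> * C"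
    proof -
      have "- (a5 * ?x2) \<le> \<bar>a5\<bar> * ?x2"
        unfolding mult_minus_left[symmetric] by (intro mult_right_mono) auto
      also have "\<dots> \<le> \<bar>a5\<bar> * (\<delta> * ?x1 + C)" using C(2)[of "norm q"] q by (intro mult_left_mono) auto
      also have "\<dots> \<le> a4 / 2 * ?x1 + \<bar>a5\<bar> * C"
        using mult_right_mono[OF \<delta>(2), of ?x1] by (simp add: distrib_left mult.assoc)
      finally show ?thesis .
    qed
    ultimately show "a4 / 2 * ?x1 - (\<bar>a6\<bar> + \<bar>a5\<bar> * C) \<le> - (gradG q \<bullet> sgn q)" by simp
  qed
qed

end

lemma exists_confining_repulsive:
  assumes "confining_potential U gradU a1 lam" and "repulsive_potential G gradG a1 \<beta>1 \<beta>2 a4 a5 a6"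
    and U: "\<And>q. GDERIV U q :> gradU q" and G: "\<And>q. q \<noteq> 0 \<Longrightarrow> GDERIV G q :> gradG q"
    and gradG: "\<And>q. q \<noteq> 0 \<Longrightarrow> norm (gradG q) \<le> a1 * (1 + norm q powr (- \<beta>1))"
    and \<beta>1: "1 \<le> \<beta>1"
  obtains A where "confining_repulsive U gradU G gradG A \<beta>1 (a4 / 2)"
proof -
  interpret U: confining_potential U gradU a1 lam by fact
  interpret G: repulsive_potential G gradG a1 \<beta>1 \<beta>2 a4 a5 a6 by fact
  let ?c = U.growth_const
  obtain C1 where G_lower: "0 \<le> C1" "\<And>q. q \<noteq> 0 \<Longrightarrow> - (C1 + a1 * norm q) \<le> G q"
    by (rule G.G_lower_bound) (rule that)
  obtain C2 where radial: "0 \<le> C2" "\<And>q. q \<noteq> 0 \<Longrightarrow> a4 / 2 * norm q powr (- \<beta>1) - C2 \<le> - (gradG q \<bullet> sgn q)"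
    by (rule G.radial_repulsion) (rule that)
  define A where "A = ?c + a1 * (1 + ?c) + (C1 + ?c * a1\<^sup>2 / 2) + C2"
  have A: "?c \<le> A" "a1 * (1 + ?c) \<le> A" "C1 + ?c * a1\<^sup>2 / 2 \<le> A" "C2 \<le> A"
    using G_lower(1) radial(1) U.growth_const_pos U.a1_pos by (auto simp: A_def)
  have "a1 \<le> a1 * (1 + ?c)" using U.a1_pos U.growth_const_pos by simp
  also note A(2)
  finally have "a1 \<le> A" .
  show thesis
  proof (rule that, unfold_locales)
    fix q
    show "GDERIV U q :> gradU q" "1 \<le> U q" "0 \<le> A" "1 \<le> \<beta>1" "0 < a4 / 2"
      using U U.U_ge_1 U.a1_pos \<open>a1 \<le> A\<close> \<beta>1 G.a4_pos by auto
    have U_nonneg: "0 \<le> U q" using U.U_ge_1[of q] by simp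
    show "norm q \<le> A * U q"
      by (rule order_trans[OF U.norm_le_U mult_right_mono[OF A(1) U_nonneg]])
    show "norm (gradU q) \<le> A * U q"
      by (rule order_trans[OF U.norm_gradU_le_U mult_right_mono[OF A(2) U_nonneg]])
    assume q: "q \<noteq> 0"
    show "GDERIV G q :> gradG q" by (rule G[OF q])
    show "norm (gradG q) \<le> A * (1 + norm q powr (- \<beta>1))"
      by (rule order_trans[OF gradG[OF q] mult_right_mono[OF \<open>a1 \<le> A\<close>]]) simp
    show "U q / 2 - A \<le> U q + G q"
      using G_lower(2)[OF q] U.linear_le_half_U[of a1 q] A(3) by simp
    show "a4 / 2 * norm q powr (- \<beta>1) - A \<le> - (gradG q \<bullet> sgn q)"
      using radial(2)[OF q] A(4) by simp
  qed
qed

section \<open>Energy estimate for perturbed trajectories\<close>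

lemma GDERIV_compose_curve:
  assumes "GDERIV K (y t) :> g" and "(y has_vector_derivative y') (at t within X)"
  shows "((\<lambda>s. K (y s)) has_real_derivative y' \<bullet> g) (at t within X)"
proof -
  have "((\<lambda>s. K (y s)) has_derivative (\<lambda>s. (s *\<^sub>R y') \<bullet> g)) (at t within X)"
    using has_derivative_compose assms unfolding has_vector_derivative_def gderiv_def by blast
  then show ?thesis
    unfolding has_field_derivative_def by (rule has_derivative_eq_rhs) (simp add: fun_eq_iff)
qed

lemma has_real_derivative_inner_sgn:
  fixes y q :: "real \<Rightarrow> 'v::euclidean_space"
  assumes q_nonzero: "q t \<noteq> 0"
    and q: "(q has_vector_derivative q') (at t within X)"
    and y: "(y has_vector_derivative y') (at t within X)"
  shows "((\<lambda>s. (y s \<bullet> q s) / norm (q s)) has_real_derivative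
     y' \<bullet> sgn (q t) + (y t \<bullet> q' - (y t \<bullet> sgn (q t)) * (q' \<bullet> sgn (q t))) / norm (q t)) (at t within X)"
proof -
  have norm_q: "((\<lambda>s. norm (q s)) has_real_derivative q' \<bullet> sgn (q t)) (at t within X)"
    by (rule GDERIV_compose_curve[OF GDERIV_norm[OF q_nonzero] q])
  have "((\<lambda>s. y s \<bullet> q s) has_derivative (\<lambda>h. y t \<bullet> (h *\<^sub>R q') + (h *\<^sub>R y') \<bullet> q t)) (at t within X)"
    using has_derivative_inner y q unfolding has_vector_derivative_def by blast
  then have y_q: "((\<lambda>s. y s \<bullet> q s) has_real_derivative y t \<bullet> q' + y' \<bullet> q t) (at t within X)"
    unfolding has_field_derivative_def
    by (rule has_derivative_eq_rhs) (simp add: fun_eq_iff algebra_simps)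
  have inner_q: "x \<bullet> q t = norm (q t) * (x \<bullet> sgn (q t))" for x
    using q_nonzero by (simp add: sgn_div_norm)
  show ?thesis
    by (rule derivative_eq_intros y_q norm_q refl)+
      (use q_nonzero in \<open>simp_all add: inner_q field_simps power2_eq_square\<close>)
qed

lemma neg_inner_le_quarter: "- (a \<bullet> b) \<le> (norm (b - a))\<^sup>2 / 4" for a b :: "'v::real_inner"
proof -
  have "0 \<le> (norm (a + b))\<^sup>2" by simp
  then show ?thesis by (simp add: power2_norm_eq_inner inner_add inner_diff inner_commute)
qed

lemma mult_le_weighted_squares:
  fixes a b T :: real
  assumes "0 < T"
  shows "a * b \<le> a\<^sup>2 / (16 * T) + 4 * T * b\<^sup>2"
proof -
  have "0 \<le> (a - 8 * T * b)\<^sup>2 / (16 * T)" using assms by simp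
  then show ?thesis using assms by (simp add: power2_eq_square field_simps)
qed

text \<open>The tangential part \<open>u\<close> of \<open>y\<close> enters as \<open>|u|\<^sup>2 + \<langle>u, h\<rangle> \<ge> -|h|\<^sup>2/4\<close>, so rotation of \<open>q/|q|\<close> can
  only decrease the radial momentum at a small rate, however fast it is.\<close>

lemma tangential_inner_ge:
  fixes y h e :: "'v::euclidean_space"
  assumes e: "norm e = 1" and c: "0 \<le> c" "c \<le> 1"
  shows "- ((norm h)\<^sup>2 / 4) \<le> y \<bullet> (c *\<^sub>R (y + h)) - (y \<bullet> e) * ((c *\<^sub>R (y + h)) \<bullet> e)"
proof -
  define u where "u = y - (y \<bullet> e) *\<^sub>R e"
  have "e \<bullet> e = 1" using e by (simp flip: power2_norm_eq_inner)
  have "0 \<le> (norm (u + (1/2) *\<^sub>R h))\<^sup>2" by simp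
  then have "- ((norm h)\<^sup>2 / 4) \<le> u \<bullet> u + u \<bullet> h"
    by (simp add: power2_norm_eq_inner inner_add inner_commute)
  then have "c * - ((norm h)\<^sup>2 / 4) \<le> c * (u \<bullet> u + u \<bullet> h)" using c(1) by (rule mult_left_mono)
  moreover have "- ((norm h)\<^sup>2 / 4) \<le> c * - ((norm h)\<^sup>2 / 4)"
    using c(2) mult_right_mono[of c 1 "(norm h)\<^sup>2 / 4"] by simp
  moreover have "c * (u \<bullet> u + u \<bullet> h) = y \<bullet> (c *\<^sub>R (y + h)) - (y \<bullet> e) * ((c *\<^sub>R (y + h)) \<bullet> e)"
    using \<open>e \<bullet> e = 1\<close> by (simp add: u_def inner_add inner_diff algebra_simps inner_commute)
  ultimately show ?thesis by linarith
qed

context confining_repulsive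
begin

definition coupling :: real where
  "coupling = 2 * A / \<gamma>"

text \<open>The coefficient of \<open>\<eta> S\<close> in the energy balance below, where \<open>\<eta>\<close> bounds the rough noise and
  \<open>S\<close> bounds \<open>K + U\<close>.\<close>

definition noise_gain :: "real \<Rightarrow> real" where
  "noise_gain T = 2 * coupling + T * (A + coupling * (1 + A))"

definition noise_tolerance :: "real \<Rightarrow> real" where
  "noise_tolerance T = min (min 1 \<gamma>) (1 / (8 * noise_gain T + 1))"

definition energy_bound :: "real \<Rightarrow> real \<Rightarrow> real" where
  "energy_bound T E = 4 * (A + \<bar>E\<bar> + 2 * coupling + T * (1 + A + coupling * (\<gamma> / 2 + A + 2))
     + 4 * T\<^sup>2 + T * coupling)"

lemma coupling_nonneg: "0 \<le> coupling"
  using A_nonneg \<gamma>_pos by (simp add: coupling_def)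

lemma
  assumes "0 \<le> T"
  shows noise_tolerance_pos: "0 < noise_tolerance T" and noise_tolerance_le_1: "noise_tolerance T \<le> 1"
    and noise_tolerance_sq_le: "(noise_tolerance T)\<^sup>2 \<le> \<gamma>"
    and noise_tolerance_gain: "noise_tolerance T * noise_gain T \<le> 1 / 8"
proof -
  have gain: "0 \<le> noise_gain T" using assms coupling_nonneg A_nonneg by (simp add: noise_gain_def)
  then show pos: "0 < noise_tolerance T" using \<gamma>_pos by (simp add: noise_tolerance_def)
  show le_1: "noise_tolerance T \<le> 1" by (simp add: noise_tolerance_def)
  have "(noise_tolerance T)\<^sup>2 \<le> noise_tolerance T"
    using pos le_1 by (simp add: power2_eq_square mult_left_le)
  also have "\<dots> \<le> \<gamma>" by (simp add: noise_tolerance_def)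
  finally show "(noise_tolerance T)\<^sup>2 \<le> \<gamma>" .
  have "noise_tolerance T * noise_gain T \<le> 1 / (8 * noise_gain T + 1) * noise_gain T"
    using gain by (intro mult_right_mono) (auto simp: noise_tolerance_def)
  also have "\<dots> \<le> 1 / 8" using gain by (simp add: field_simps)
  finally show "noise_tolerance T * noise_gain T \<le> 1 / 8" .
qed

lemma inverse_norm_le:
  assumes "q \<noteq> 0"
  shows "1 / norm (q :: 'v) \<le> 1 + norm q powr (- \<beta>)"
  using powr_le_one_plus_powr[of "1 / norm q" 1 \<beta>] assms \<beta>_ge_1
  by (simp add: powr_minus_divide powr_divide)

end

text \<open>Here \<open>y + h\<close> is the momentum, \<open>h\<close> the rough and small part of the noise and \<open>f\<close> the derivative of
  its smooth part.\<close>

locale perturbed_trajectory =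
  confining_repulsive U gradU G gradG A \<beta> \<gamma> + kinetic_energy v K
  for U :: "'v::euclidean_space \<Rightarrow> real" and gradU G gradG A \<beta> \<gamma> v K +
  fixes T L :: real and h f y q :: "real \<Rightarrow> 'v"
  assumes T_pos: "0 < T"
    and q_nonzero: "t \<in> {0..T} \<Longrightarrow> q t \<noteq> 0"
    and norm_h_le: "t \<in> {0..T} \<Longrightarrow> norm (h t) \<le> noise_tolerance T"
    and norm_f_le: "t \<in> {0..T} \<Longrightarrow> norm (f t) \<le> L"
    and q_deriv: "t \<in> {0..T} \<Longrightarrow> (q has_vector_derivative v (y t + h t)) (at t within {0..T})"
    and y_deriv: "t \<in> {0..T} \<Longrightarrow>
      (y has_vector_derivative (- v (y t + h t) - (gradU (q t) + gradG (q t)) + f t))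
        (at t within {0..T})"
begin

abbreviation \<eta> :: real where
  "\<eta> \<equiv> noise_tolerance T"

lemmas \<eta>_pos = noise_tolerance_pos[OF less_imp_le[OF T_pos]]
  and \<eta>_le_1 = noise_tolerance_le_1[OF less_imp_le[OF T_pos]]
  and \<eta>_sq_le = noise_tolerance_sq_le[OF less_imp_le[OF T_pos]]
  and \<eta>_gain = noise_tolerance_gain[OF less_imp_le[OF T_pos]]

definition energy :: "real \<Rightarrow> real" where
  "energy t = K (y t) + U (q t) + G (q t)"

definition energy_rate :: "real \<Rightarrow> real" where
  "energy_rate t = - (v (y t) \<bullet> v (y t + h t)) + v (y t) \<bullet> f t
     + (gradU (q t) + gradG (q t)) \<bullet> (v (y t + h t) - v (y t))"

definition radial_momentum :: "real \<Rightarrow> real" where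
  "radial_momentum t = (y t \<bullet> q t) / norm (q t)"

definition radial_rate :: "real \<Rightarrow> real" where
  "radial_rate t = (- v (y t + h t) - (gradU (q t) + gradG (q t)) + f t) \<bullet> sgn (q t)
     + (y t \<bullet> v (y t + h t) - (y t \<bullet> sgn (q t)) * (v (y t + h t) \<bullet> sgn (q t))) / norm (q t)"

definition lyapunov :: "real \<Rightarrow> real" where
  "lyapunov t = energy t - \<eta> * coupling * radial_momentum t"

definition lyapunov_rate :: "real \<Rightarrow> real" where
  "lyapunov_rate t = energy_rate t - \<eta> * coupling * radial_rate t"

definition lyapunov_rate_bound :: "real \<Rightarrow> real" where
  "lyapunov_rate_bound S = 1 + (S / (8 * T) + 4 * T * L\<^sup>2) + \<eta> * A * S + \<eta> * A
     + \<eta> * coupling * (\<gamma> / 2 + A + 2 + (1 + A) * S + L)"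

lemma L_nonneg: "0 \<le> L"
  using order_trans[OF norm_ge_zero norm_f_le[of 0]] T_pos by simp

lemma energy_has_derivative:
  assumes "t \<in> {0..T}"
  shows "(energy has_real_derivative energy_rate t) (at t within {0..T})"
  unfolding energy_def[abs_def] energy_rate_def
  by (rule derivative_eq_intros GDERIV_compose_curve[OF _ q_deriv] GDERIV_compose_curve[OF _ y_deriv]
      GDERIV_K GDERIV_U GDERIV_G q_nonzero assms refl)+
    (simp add: inner_diff inner_add algebra_simps inner_commute)

lemma radial_momentum_has_derivative:
  assumes "t \<in> {0..T}"
  shows "(radial_momentum has_real_derivative radial_rate t) (at t within {0..T})"
  unfolding radial_momentum_def[abs_def] radial_rate_def
  by (rule has_real_derivative_inner_sgn[OF q_nonzero q_deriv y_deriv]) (rule assms)+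

lemma lyapunov_has_derivative:
  assumes "t \<in> {0..T}"
  shows "(lyapunov has_real_derivative lyapunov_rate t) (at t within {0..T})"
  unfolding lyapunov_def[abs_def] lyapunov_rate_def
  by (intro DERIV_diff DERIV_cmult energy_has_derivative radial_momentum_has_derivative assms)

lemma norm_gradU_le_of_energy:
  assumes "K (y t) + U (q t) \<le> S"
  shows "norm (gradU (q t)) \<le> A * S"
proof (rule order_trans[OF norm_gradU_le mult_left_mono[OF _ A_nonneg]])
  show "U (q t) \<le> S" using assms K_nonneg[of "y t"] by simp
qed

lemma energy_rate_le:
  assumes t: "t \<in> {0..T}" and S: "K (y t) + U (q t) \<le> S"
  shows "energy_rate t
      \<le> 1 + (S / (8 * T) + 4 * T * L\<^sup>2) + \<eta> * A * S + \<eta> * A * (1 + norm (q t) powr (- \<beta>))"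
proof -
  let ?dv = "v (y t + h t) - v (y t)"
  have dv: "norm ?dv \<le> \<eta>"
    using lipschitz_onD[OF v_lipschitz, of "y t + h t" "y t"] norm_h_le[OF t] by (simp add: dist_norm)
  have "- (v (y t) \<bullet> v (y t + h t)) \<le> (norm ?dv)\<^sup>2 / 4" by (rule neg_inner_le_quarter)
  also have "(norm ?dv)\<^sup>2 \<le> 1\<^sup>2" using dv \<eta>_le_1 by (intro power_mono) auto
  finally have friction: "- (v (y t) \<bullet> v (y t + h t)) \<le> 1" by simp
  have "v (y t) \<bullet> f t \<le> norm (v (y t)) * norm (f t)" by (rule norm_cauchy_schwarz)
  also have "\<dots> \<le> norm (v (y t)) * L" using norm_f_le[OF t] by (intro mult_left_mono) auto
  also have "\<dots> \<le> (norm (v (y t)))\<^sup>2 / (16 * T) + 4 * T * L\<^sup>2"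
    by (rule mult_le_weighted_squares[OF T_pos])
  also have "(norm (v (y t)))\<^sup>2 / (16 * T) \<le> 2 * S / (16 * T)"
    using norm_v_sq_le[of "y t"] S U_ge_1[of "q t"] T_pos by (intro divide_right_mono) auto
  finally have forcing: "v (y t) \<bullet> f t \<le> S / (8 * T) + 4 * T * L\<^sup>2" by simp
  have cauchy: "g \<bullet> ?dv \<le> B * \<eta>" if "norm g \<le> B" for g B
    using norm_cauchy_schwarz[of g ?dv] mult_mono[OF that dv] order_trans[OF norm_ge_zero that]
    by simp
  from cauchy[OF norm_gradU_le_of_energy[OF S]] cauchy[OF norm_gradG_le[OF q_nonzero[OF t]]]
    friction forcing
  show ?thesis
    unfolding energy_rate_def inner_add_left by (simp add: mult_ac)
qed

lemma radial_rate_ge: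
  assumes t: "t \<in> {0..T}" and S: "K (y t) + U (q t) \<le> S"
  shows "\<gamma> / 2 * norm (q t) powr (- \<beta>) - (\<gamma> / 2 + A + 2 + (1 + A) * S + L) \<le> radial_rate t"
proof -
  let ?e = "sgn (q t)" and ?v = "v (y t + h t)" and ?x = "norm (q t) powr (- \<beta>)"
  have e: "norm ?e = 1" using q_nonzero[OF t] by (simp add: norm_sgn)
  then have cauchy: "z \<bullet> ?e \<le> norm z" "- norm z \<le> z \<bullet> ?e" for z
    using Cauchy_Schwarz_ineq2[of z ?e] by auto
  obtain c where c: "0 \<le> c" "c \<le> 1" "?v = c *\<^sub>R (y t + h t)" using v_parallel by blast
  have "norm ?v \<le> norm (y t + h t)" using c by (simp add: mult_left_le_one_le)
  also have "\<dots> \<le> (S + 1) + 1"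
    using norm_triangle_ineq[of "y t" "h t"] norm_le_K[of "y t"] norm_h_le[OF t] \<eta>_le_1 S
      U_ge_1[of "q t"] by simp
  finally have friction: "?v \<bullet> ?e \<le> S + 2" using cauchy(1)[of ?v] by simp
  have confinement: "gradU (q t) \<bullet> ?e \<le> A * S"
    by (rule order_trans[OF cauchy(1) norm_gradU_le_of_energy[OF S]])
  have forcing: "- L \<le> f t \<bullet> ?e" using cauchy(2)[of "f t"] norm_f_le[OF t] by simp
  have "(norm (h t))\<^sup>2 \<le> \<eta>\<^sup>2" using norm_h_le[OF t] by (intro power_mono) auto
  then have "(norm (h t))\<^sup>2 / 4 * (1 / norm (q t)) \<le> \<gamma> / 2 * (1 + ?x)"
    using \<eta>_sq_le \<gamma>_pos by (intro mult_mono inverse_norm_le q_nonzero[OF t]) auto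
  moreover
  have "- ((norm (h t))\<^sup>2 / 4) / norm (q t) \<le> (y t \<bullet> ?v - (y t \<bullet> ?e) * (?v \<bullet> ?e)) / norm (q t)"
    unfolding c(3) by (intro divide_right_mono tangential_inner_ge e c) simp
  ultimately have "- (\<gamma> / 2 * (1 + ?x)) \<le> (y t \<bullet> ?v - (y t \<bullet> ?e) * (?v \<bullet> ?e)) / norm (q t)" by simp
  then show ?thesis
    using friction confinement forcing repulsion[OF q_nonzero[OF t]]
    unfolding radial_rate_def inner_add_left inner_diff_left inner_minus_left
    by (simp add: algebra_simps)
qed

text \<open>The choice of the coupling makes the singular terms of the two rates cancel.\<close>

lemma lyapunov_rate_le:
  assumes t: "t \<in> {0..T}" and S: "K (y t) + U (q t) \<le> S"
  shows "lyapunov_rate t \<le> lyapunov_rate_bound S"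
proof -
  let ?x = "norm (q t) powr (- \<beta>)" and ?R = "\<gamma> / 2 + A + 2 + (1 + A) * S + L"
  have "\<eta> * coupling * (\<gamma> / 2 * ?x - ?R) \<le> \<eta> * coupling * radial_rate t"
    using \<eta>_pos coupling_nonneg by (intro mult_left_mono radial_rate_ge[OF t S]) auto
  moreover have "\<eta> * coupling * (\<gamma> / 2 * ?x - ?R) = \<eta> * A * ?x - \<eta> * coupling * ?R"
    using \<gamma>_pos by (simp add: coupling_def right_diff_distrib)
  ultimately show ?thesis
    using energy_rate_le[OF t S]
    by (simp add: lyapunov_rate_def lyapunov_rate_bound_def distrib_left)
qed

lemma abs_radial_momentum_le:
  assumes t: "t \<in> {0..T}" and S: "K (y t) + U (q t) \<le> S"
  shows "\<bar>radial_momentum t\<bar> \<le> S + 1"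
proof -
  have "\<bar>radial_momentum t\<bar> \<le> norm (y t)"
    using Cauchy_Schwarz_ineq2[of "y t" "q t"] q_nonzero[OF t]
    by (simp add: radial_momentum_def pos_divide_le_eq)
  then show ?thesis using norm_le_K[of "y t"] S U_ge_1[of "q t"] by simp
qed

lemma lyapunov_increment_le:
  assumes S: "\<And>s. s \<in> {0..T} \<Longrightarrow> K (y s) + U (q s) \<le> S" and t: "t \<in> {0..T}"
  shows "lyapunov t - lyapunov 0 \<le> T * lyapunov_rate_bound S"
proof -
  have "(lyapunov has_derivative (*) (lyapunov_rate s)) (at s within {0..t})" if "0 \<le> s" "s \<le> t" for s
    unfolding has_field_derivative_def[symmetric]
    by (rule has_field_derivative_subset[OF lyapunov_has_derivative]) (use t that in auto)
  from mvt_very_simple[OF _ this] t obtain s where s: "s \<in> {0..t}"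
    and increment: "lyapunov t - lyapunov 0 = lyapunov_rate s * (t - 0)" by auto
  note increment
  also have "lyapunov_rate s * (t - 0) \<le> lyapunov_rate_bound S * (t - 0)"
    using s t by (intro mult_right_mono lyapunov_rate_le S) auto
  also have "\<dots> \<le> lyapunov_rate_bound S * T"
  proof (rule mult_left_mono)
    have "0 \<le> S" using S[OF t] K_nonneg[of "y t"] U_ge_1[of "q t"] by simp
    then show "0 \<le> lyapunov_rate_bound S"
      using T_pos \<eta>_pos A_nonneg \<gamma>_pos coupling_nonneg L_nonneg by (simp add: lyapunov_rate_bound_def)
  qed (use t in simp)
  finally show ?thesis by (simp add: mult.commute)
qed

lemma energy_halving:
  assumes S: "\<And>s. s \<in> {0..T} \<Longrightarrow> K (y s) + U (q s) \<le> S" and E: "energy 0 \<le> E" and t: "t \<in> {0..T}"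
  shows "2 * (K (y t) + U (q t)) \<le> S + energy_bound T E * (1 + L\<^sup>2)"
proof -
  have T0: "0 \<in> {0..T}" using T_pos by simp
  have "1 \<le> S" using S[OF t] K_nonneg[of "y t"] U_ge_1[of "q t"] by simp
  have "(K (y t) + U (q t)) / 2 - A \<le> energy t"
    using potential_lower_bound[OF q_nonzero[OF t]] K_nonneg[of "y t"]
    by (simp add: energy_def field_simps)
  moreover
  have "\<eta> * coupling * (radial_momentum t - radial_momentum 0) \<le> \<eta> * coupling * (2 * (S + 1))"
    using abs_radial_momentum_le[OF t S[OF t]] abs_radial_momentum_le[OF T0 S[OF T0]] \<eta>_pos
      coupling_nonneg
    by (intro mult_left_mono) auto
  ultimately have "(K (y t) + U (q t)) / 2 \<le> A + E + 2 * (\<eta> * coupling) + S / 8 + 4 * T\<^sup>2 * L\<^sup>2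
      + \<eta> * noise_gain T * S + T * (1 + \<eta> * A + \<eta> * coupling * (\<gamma> / 2 + A + 2) + \<eta> * coupling * L)"
    using lyapunov_increment_le[OF S t] E T_pos
    by (simp add: lyapunov_def lyapunov_rate_bound_def noise_gain_def power2_eq_square algebra_simps)
  also have "\<dots> \<le> A + \<bar>E\<bar> + 2 * coupling + S / 8 + 4 * T\<^sup>2 * (1 + L\<^sup>2)
      + 1 / 8 * S + T * (1 + A + coupling * (\<gamma> / 2 + A + 2) + coupling * (1 + L\<^sup>2))"
  proof -
    have "\<eta> * coupling \<le> coupling" "\<eta> * A \<le> A"
      using \<eta>_pos \<eta>_le_1 coupling_nonneg A_nonneg by (auto simp: mult_left_le_one_le)
    moreover have "L \<le> 1 + L\<^sup>2"
      using sum_power2_ge_zero[of "L - 1" 0] L_nonneg by (simp add: power2_diff)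
    ultimately show ?thesis
      using \<eta>_gain \<eta>_pos \<open>1 \<le> S\<close> T_pos coupling_nonneg A_nonneg \<gamma>_pos L_nonneg
      by (intro add_mono mult_left_mono mult_right_mono mult_mono) auto
  qed
  also have "\<dots> \<le> S / 4 + energy_bound T E * (1 + L\<^sup>2) / 4"
  proof -
    have "0 \<le> (A + \<bar>E\<bar> + 2 * coupling + T * (1 + A + coupling * (\<gamma> / 2 + A + 2))) * L\<^sup>2"
      using A_nonneg coupling_nonneg T_pos \<gamma>_pos by simp
    then show ?thesis by (simp add: energy_bound_def algebra_simps)
  qed
  finally show ?thesis by simp
qed

theorem energy_le_energy_bound:
  assumes E: "energy 0 \<le> E" and t: "t \<in> {0..T}"
  shows "K (y t) + U (q t) \<le> energy_bound T E * (1 + L\<^sup>2)"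
proof -
  have "continuous_on {0..T} (\<lambda>t. K (y t) + U (q t))"
    unfolding continuous_on_eq_continuous_within
    by (intro ballI continuous_add DERIV_continuous[OF GDERIV_compose_curve[OF GDERIV_K y_deriv]]
        DERIV_continuous[OF GDERIV_compose_curve[OF GDERIV_U q_deriv]])
  then obtain \<tau> where \<tau>: "\<tau> \<in> {0..T}"
    and max: "\<And>s. s \<in> {0..T} \<Longrightarrow> K (y s) + U (q s) \<le> K (y \<tau>) + U (q \<tau>)"
    using continuous_attains_sup[OF compact_Icc, of 0 T] T_pos by force
  have "2 * (K (y \<tau>) + U (q \<tau>)) \<le> (K (y \<tau>) + U (q \<tau>)) + energy_bound T E * (1 + L\<^sup>2)"
    by (rule energy_halving[OF max E \<tau>])
  then have "K (y \<tau>) + U (q \<tau>) \<le> energy_bound T E * (1 + L\<^sup>2)" by simp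
  then show ?thesis using max[OF t] by (rule order_trans[rotated])
qed

end

section \<open>Path bounds for one particle\<close>

definition oscillation_le :: "(real \<Rightarrow> 'v::metric_space) \<Rightarrow> real \<Rightarrow> real \<Rightarrow> real \<Rightarrow> bool" where
  "oscillation_le w T \<delta> \<theta> \<longleftrightarrow> (\<forall>t\<in>{0..T}. \<forall>s\<in>{t..t + \<delta>}. dist (w s) (w t) \<le> \<theta>)"

definition moving_average :: "real \<Rightarrow> (real \<Rightarrow> 'v::banach) \<Rightarrow> real \<Rightarrow> 'v" where
  "moving_average \<delta> w t = (1 / \<delta>) *\<^sub>R integral {t..t + \<delta>} w"

lemma moving_average_has_derivative:
  fixes w :: "real \<Rightarrow> 'v::banach"
  assumes w: "continuous_on {0..} w" and \<delta>: "0 < \<delta>" and t: "t \<in> {0..T}"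
  shows "(moving_average \<delta> w has_vector_derivative (1 / \<delta>) *\<^sub>R (w (t + \<delta>) - w t))
      (at t within {0..T})"
proof -
  let ?I = "\<lambda>u. integral {0..u} w"
  have cont: "continuous_on {0..a} w" for a by (rule continuous_on_subset[OF w]) auto
  have I_derivative: "(?I has_vector_derivative w u) (at u within X)"
    if "X \<subseteq> {0..T + \<delta>}" "u \<in> {0..T + \<delta>}" for u X
    using integral_has_vector_derivative[OF cont that(2)] that(1)
    by (rule has_vector_derivative_within_subset)
  have "(?I \<circ> (\<lambda>u. u + \<delta>) has_vector_derivative 1 *\<^sub>R w (t + \<delta>)) (at t within {0..T})"
    by (rule vector_diff_chain_within) (use t \<delta> in \<open>auto intro!: derivative_eq_intros I_derivative\<close>)
  then have "((\<lambda>u. (1 / \<delta>) *\<^sub>R (?I (u + \<delta>) - ?I u))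
      has_vector_derivative (1 / \<delta>) *\<^sub>R (w (t + \<delta>) - w t))
      (at t within {0..T})"
    using t \<delta> by (auto simp: o_def intro!: derivative_eq_intros I_derivative)
  moreover have "moving_average \<delta> w u = (1 / \<delta>) *\<^sub>R (?I (u + \<delta>) - ?I u)" if "u \<in> {0..T}" for u
    using Henstock_Kurzweil_Integration.integral_combine[of 0 u "u + \<delta>" w] that \<delta>
      integrable_continuous_real[OF cont]
    by (simp add: moving_average_def algebra_simps flip: scaleR_add_right)
  ultimately show ?thesis by (rule has_vector_derivative_transform[OF t, rotated])
qed

lemma dist_moving_average_le:
  fixes w :: "real \<Rightarrow> 'v::euclidean_space"
  assumes w: "continuous_on {0..} w" and \<delta>: "0 < \<delta>" and t: "t \<in> {0..T}"
    and osc: "oscillation_le w T \<delta> \<theta>"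
  shows "dist (w t) (moving_average \<delta> w t) \<le> \<theta>"
proof -
  have cont: "continuous_on {t..t + \<delta>} w" by (rule continuous_on_subset[OF w]) (use t in auto)
  have "integral {t..t + \<delta>} (\<lambda>s. w t - w s) = \<delta> *\<^sub>R w t - integral {t..t + \<delta>} w"
    using \<delta> integrable_continuous_real[OF cont] by (subst integral_diff) auto
  then have "w t - moving_average \<delta> w t = (1 / \<delta>) *\<^sub>R integral {t..t + \<delta>} (\<lambda>s. w t - w s)"
    using \<delta> by (simp add: moving_average_def scaleR_diff_right)
  moreover have "norm (integral {t..t + \<delta>} (\<lambda>s. w t - w s)) \<le> \<theta> * ((t + \<delta>) - t)"
    using \<delta> t osc
    by (intro integral_bound continuous_intros cont)
      (auto simp: oscillation_le_def dist_norm norm_minus_commute[of "w t"])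
  ultimately show ?thesis using \<delta> by (simp add: dist_norm pos_divide_le_eq mult.commute)
qed

lemma
  assumes sol: "path_sol vel F S w q0 p0 q p"
    and vel: "continuous_on UNIV vel" and F: "continuous_on S F" and t: "t \<in> {0..T}"
  shows path_sol_position_derivative: "(q has_vector_derivative vel (p t)) (at t within {0..T})"
    and path_sol_momentum_derivative:
      "((\<lambda>t. p t - sqrt 2 *\<^sub>R w t) has_vector_derivative - vel (p t) - F (q t))
        (at t within {0..T})"
proof -
  note cont = path_sol_continuous_on_Icc[OF sol vel F]
  have "((\<lambda>u. q0 + integral {0..u} (\<lambda>s. vel (p s))) has_vector_derivative vel (p t))
      (at t within {0..T})"
    by (auto intro!: derivative_eq_intros integral_has_vector_derivative[OF cont(3) t])
  then show "(q has_vector_derivative vel (p t)) (at t within {0..T})"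
    using path_sol_position[OF sol] by (rule has_vector_derivative_transform[OF t, rotated]) simp
  have "((\<lambda>u. p0 + integral {0..u} (\<lambda>s. - vel (p s) - F (q s)))
      has_vector_derivative - vel (p t) - F (q t))
      (at t within {0..T})"
    using cont by (auto intro!: derivative_eq_intros integral_has_vector_derivative[OF _ t]
        continuous_intros)
  then show "((\<lambda>t. p t - sqrt 2 *\<^sub>R w t) has_vector_derivative - vel (p t) - F (q t))
      (at t within {0..T})"
  proof (rule has_vector_derivative_transform[OF t, rotated])
    show "p u - sqrt 2 *\<^sub>R w u = p0 + integral {0..u} (\<lambda>s. - vel (p s) - F (q s))"
      if "u \<in> {0..T}" for u
      using path_sol_momentum[OF sol, of u] that by (simp add: algebra_simps)
  qed
qed

definition (in confining_repulsive) path_bound :: "real \<Rightarrow> 'v \<Rightarrow> 'v \<Rightarrow> real" where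
  "path_bound T q0 p0 = (1 + A) * energy_bound T ((norm p0 + 1)\<^sup>2 + U q0 + G q0) + 2"

locale one_particle_path =
  confining_repulsive U gradU G gradG A \<beta> \<gamma> + kinetic_energy v K
  for U :: "'v::euclidean_space \<Rightarrow> real" and gradU G gradG A \<beta> \<gamma> v K +
  fixes T \<delta> :: real and w q p :: "real \<Rightarrow> 'v" and q0 p0 :: 'v
  assumes T_pos: "0 < T" and \<delta>_pos: "0 < \<delta>"
    and cont_F: "continuous_on (- {0}) (\<lambda>x. gradU x + gradG x)"
    and cont_w: "continuous_on {0..} w" and w_0: "w 0 = 0"
    and oscillation: "oscillation_le w T \<delta> (noise_tolerance T / sqrt 2)"
    and path_sol: "path_sol v (\<lambda>x. gradU x + gradG x) (- {0}) w q0 p0 q p"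
begin

definition rough_noise :: "real \<Rightarrow> 'v" where
  "rough_noise t = sqrt 2 *\<^sub>R (w t - moving_average \<delta> w t)"

definition smooth_noise_rate :: "real \<Rightarrow> 'v" where
  "smooth_noise_rate t = (sqrt 2 / \<delta>) *\<^sub>R (w (t + \<delta>) - w t)"

definition smooth_momentum :: "real \<Rightarrow> 'v" where
  "smooth_momentum t = p t - rough_noise t"

lemma norm_rough_noise_le:
  assumes "t \<in> {0..T}"
  shows "norm (rough_noise t) \<le> noise_tolerance T"
  using mult_left_mono[OF dist_moving_average_le[OF cont_w \<delta>_pos assms oscillation], of "sqrt 2"]
  by (simp add: rough_noise_def dist_norm)

sublocale perturbed_trajectory U gradU G gradG A \<beta> \<gamma> v K
  T "noise_tolerance T / \<delta>" rough_noise smooth_noise_rate smooth_momentum q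
proof
  fix t assume t: "t \<in> {0..T}"
  have cont_v: "continuous_on UNIV v" by (rule lipschitz_on_continuous_on[OF v_lipschitz])
  have momentum: "smooth_momentum t + rough_noise t = p t" by (simp add: smooth_momentum_def)
  show "norm (rough_noise t) \<le> noise_tolerance T" by (rule norm_rough_noise_le[OF t])
  show "q t \<noteq> 0" using path_sol_in_domain[OF path_sol, of t] t by simp
  have "dist (w (t + \<delta>)) (w t) \<le> noise_tolerance T / sqrt 2"
    using oscillation t \<delta>_pos by (auto simp: oscillation_le_def)
  then have "sqrt 2 * norm (w (t + \<delta>) - w t) \<le> noise_tolerance T"
    by (simp add: dist_norm field_simps)
  then show "norm (smooth_noise_rate t) \<le> noise_tolerance T / \<delta>"
    using \<delta>_pos by (simp add: smooth_noise_rate_def divide_right_mono)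
  show "(q has_vector_derivative v (smooth_momentum t + rough_noise t)) (at t within {0..T})"
    unfolding momentum by (rule path_sol_position_derivative[OF path_sol cont_v cont_F t])
  have "((\<lambda>t. sqrt 2 *\<^sub>R moving_average \<delta> w t) has_vector_derivative smooth_noise_rate t)
      (at t within {0..T})"
    unfolding smooth_noise_rate_def
    using moving_average_has_derivative[OF cont_w \<delta>_pos t] by (auto intro!: derivative_eq_intros)
  from has_vector_derivative_add[OF path_sol_momentum_derivative[OF path_sol cont_v cont_F t] this]
  show "(smooth_momentum has_vector_derivative
      - v (smooth_momentum t + rough_noise t) - (gradU (q t) + gradG (q t)) + smooth_noise_rate t)
      (at t within {0..T})"
    unfolding momentum smooth_momentum_def[abs_def] rough_noise_def by (simp add: algebra_simps)
qed (rule T_pos)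

lemma initial_energy_le: "energy 0 \<le> (norm p0 + 1)\<^sup>2 + U q0 + G q0"
proof -
  have T0: "0 \<in> {0..T}" using T_pos by simp
  have init: "q 0 = q0" "p 0 = p0"
    using path_sol_position[OF path_sol, of 0] path_sol_momentum[OF path_sol, of 0] w_0 by auto
  have "norm (smooth_momentum 0) \<le> norm p0 + 1"
    using norm_triangle_ineq4[of "p 0" "rough_noise 0"] norm_rough_noise_le[OF T0] \<eta>_le_1 init
    by (simp add: smooth_momentum_def)
  then have "(norm (smooth_momentum 0))\<^sup>2 \<le> (norm p0 + 1)\<^sup>2" by (intro power_mono) auto
  with K_le_norm_sq[of "smooth_momentum 0"] have "K (smooth_momentum 0) \<le> (norm p0 + 1)\<^sup>2"
    by (rule order_trans)
  then show ?thesis by (simp add: energy_def init)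
qed

theorem norm_path_le:
  assumes t: "t \<in> {0..T}"
  shows "norm (q t) \<le> path_bound T q0 p0 * (1 + 1 / \<delta>\<^sup>2)"
    and "norm (p t) \<le> path_bound T q0 p0 * (1 + 1 / \<delta>\<^sup>2)"
proof -
  define B where "B = energy_bound T ((norm p0 + 1)\<^sup>2 + U q0 + G q0)"
  define X where "X = 1 + 1 / \<delta>\<^sup>2"
  have "0 \<le> B" unfolding B_def energy_bound_def
    using A_nonneg coupling_nonneg T_pos \<gamma>_pos by simp
  have "1 \<le> X" by (simp add: X_def)
  have "(noise_tolerance T / \<delta>)\<^sup>2 \<le> 1 / \<delta>\<^sup>2"
    using \<eta>_pos \<eta>_le_1 by (simp add: power_divide divide_right_mono power_le_one)
  then have "B * (1 + (noise_tolerance T / \<delta>)\<^sup>2) \<le> B * X"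
    unfolding X_def using \<open>0 \<le> B\<close> by (intro mult_left_mono) auto
  then have KU: "K (smooth_momentum t) + U (q t) \<le> B * X"
    using energy_le_energy_bound[OF initial_energy_le t] by (simp add: B_def)
  have "norm (q t) \<le> A * (B * X)"
    using norm_le_U[of "q t"] KU K_nonneg[of "smooth_momentum t"] A_nonneg
    by (intro order_trans[OF norm_le_U mult_left_mono]) auto
  also have "\<dots> \<le> ((1 + A) * B + 2) * X" using \<open>0 \<le> B\<close> \<open>1 \<le> X\<close> by (simp add: algebra_simps)
  finally show "norm (q t) \<le> path_bound T q0 p0 * (1 + 1 / \<delta>\<^sup>2)"
    by (simp add: path_bound_def B_def X_def)
  have "norm (p t) \<le> norm (smooth_momentum t) + norm (rough_noise t)"
    using norm_triangle_ineq[of "smooth_momentum t" "rough_noise t"]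
    by (simp add: smooth_momentum_def)
  also have "\<dots> \<le> B * X + 2"
    using norm_le_K[of "smooth_momentum t"] norm_rough_noise_le[OF t] \<eta>_le_1 KU U_ge_1[of "q t"]
    by simp
  also have "\<dots> \<le> ((1 + A) * B + 2) * X"
    using \<open>0 \<le> B\<close> \<open>1 \<le> X\<close> A_nonneg by (simp add: algebra_simps add_increasing)
  finally show "norm (p t) \<le> path_bound T q0 p0 * (1 + 1 / \<delta>\<^sup>2)"
    by (simp add: path_bound_def B_def X_def)
qed

end

section \<open>Moments of the modulus of continuity of Brownian motion\<close>

definition hoelder_sum :: "real \<Rightarrow> nat \<Rightarrow> nat \<Rightarrow> (real \<Rightarrow> 'b::real_normed_vector) \<Rightarrow> ennreal" where
  "hoelder_sum r k J w = (\<Sum>m. \<Sum>j<J * 2 ^ m.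
     ennreal ((norm (w ((real j + 1) / 2 ^ m) - w (real j / 2 ^ m)) / r ^ m) ^ k))"

lemma hoelder_sum_measurable:
  fixes W :: "real \<Rightarrow> 'a \<Rightarrow> 'b::euclidean_space"
  assumes [measurable]: "\<And>t. W t \<in> borel_measurable M"
  shows "(\<lambda>\<omega>. hoelder_sum r k J (\<lambda>t. W t \<omega>)) \<in> borel_measurable M"
  unfolding hoelder_sum_def by measurable

lemma nn_integral_dyadic_increment_le:
  fixes W :: "real \<Rightarrow> 'a \<Rightarrow> 'b::euclidean_space"
  assumes [measurable]: "\<And>t. W t \<in> borel_measurable M"
    and moment: "\<And>s t. 0 \<le> s \<Longrightarrow> s < t \<Longrightarrow>
      (\<integral>\<^sup>+\<omega>. ennreal (norm (W t \<omega> - W s \<omega>) ^ k) \<partial>M) \<le> ennreal (C * (t - s) ^ l)"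
    and C: "0 \<le> C" and r: "0 < r"
  shows "(\<integral>\<^sup>+\<omega>. ennreal ((norm (W ((real j + 1) / 2 ^ m) \<omega> - W (real j / 2 ^ m) \<omega>) / r ^ m) ^ k) \<partial>M)
    \<le> ennreal (C * (1 / (r ^ k * 2 ^ l)) ^ m)"
proof -
  let ?D = "\<lambda>\<omega>. norm (W ((real j + 1) / 2 ^ m) \<omega> - W (real j / 2 ^ m) \<omega>)"
  have "(\<integral>\<^sup>+\<omega>. ennreal ((?D \<omega> / r ^ m) ^ k) \<partial>M)
      = (\<integral>\<^sup>+\<omega>. ennreal (1 / (r ^ m) ^ k) * ennreal (?D \<omega> ^ k) \<partial>M)"
    using r by (intro nn_integral_cong) (simp add: power_divide flip: ennreal_mult)
  also have "\<dots> = ennreal (1 / (r ^ m) ^ k) * (\<integral>\<^sup>+\<omega>. ennreal (?D \<omega> ^ k) \<partial>M)"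
    by (rule nn_integral_cmult) measurable
  also have "\<dots>
      \<le> ennreal (1 / (r ^ m) ^ k) * ennreal (C * ((real j + 1) / 2 ^ m - real j / 2 ^ m) ^ l)"
    by (intro mult_left_mono moment) (auto simp: divide_strict_right_mono)
  also have "\<dots> = ennreal (1 / (r ^ m) ^ k * (C * (1 / 2 ^ m) ^ l))"
    using C r by (subst ennreal_mult) (auto simp: add_divide_distrib)
  also have "1 / (r ^ m) ^ k * (C * (1 / 2 ^ m) ^ l) = C * (1 / (r ^ k * 2 ^ l)) ^ m"
    by (simp add: power_divide power_mult_distrib flip: power_mult) (simp add: mult.commute)
  finally show ?thesis .
qed

lemma nn_integral_hoelder_sum_finite:
  fixes W :: "real \<Rightarrow> 'a \<Rightarrow> 'b::euclidean_space"
  assumes [measurable]: "\<And>t. W t \<in> borel_measurable M"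
    and moment: "\<And>s t. 0 \<le> s \<Longrightarrow> s < t \<Longrightarrow>
      (\<integral>\<^sup>+\<omega>. ennreal (norm (W t \<omega> - W s \<omega>) ^ k) \<partial>M) \<le> ennreal (C * (t - s) ^ l)"
    and C: "0 \<le> C" and r: "0 < r" "2 < r ^ k * 2 ^ l"
  shows "(\<integral>\<^sup>+\<omega>. hoelder_sum r k J (\<lambda>t. W t \<omega>) \<partial>M) < \<infinity>"
proof -
  define x where "x = 1 / (r ^ k * 2 ^ l)"
  have x: "0 \<le> x" "2 * x < 1" using r by (auto simp: x_def divide_less_eq)
  let ?I = "\<lambda>m j. \<integral>\<^sup>+\<omega>. ennreal
    ((norm (W ((real j + 1) / 2 ^ m) \<omega> - W (real j / 2 ^ m) \<omega>) / r ^ m) ^ k) \<partial>M"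
  have "(\<integral>\<^sup>+\<omega>. hoelder_sum r k J (\<lambda>t. W t \<omega>) \<partial>M) = (\<Sum>m. \<Sum>j<J * 2 ^ m. ?I m j)"
    unfolding hoelder_sum_def by (simp add: nn_integral_suminf nn_integral_sum)
  also have "\<dots> \<le> (\<Sum>m. ennreal (real J * C * (2 * x) ^ m))"
  proof (rule suminf_le)
    fix m
    have "(\<Sum>j<J * 2 ^ m. ?I m j) \<le> (\<Sum>j<J * 2 ^ m. ennreal (C * x ^ m))"
      unfolding x_def by (intro sum_mono nn_integral_dyadic_increment_le moment C r(1)) measurable
    also have "\<dots> = ennreal (\<Sum>j<J * 2 ^ m. C * x ^ m)" using C x by (intro sum_ennreal) auto
    also have "(\<Sum>j<J * 2 ^ m. C * x ^ m) = real J * C * (2 * x) ^ m" by (simp add: power_mult_distrib)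
    finally show "(\<Sum>j<J * 2 ^ m. ?I m j) \<le> ennreal (real J * C * (2 * x) ^ m)" .
  qed auto
  also have "\<dots> < \<infinity>"
  proof -
    have "summable (\<lambda>m. real J * C * (2 * x) ^ m)"
      using x by (intro summable_mult summable_geometric) auto
    then show ?thesis using C x by (subst suminf_ennreal2) auto
  qed
  finally show ?thesis .
qed

lemma hoelder_sum_increment_le:
  assumes fin: "hoelder_sum r k J w = ennreal y" and y: "0 \<le> y" and r: "0 < r" and k: "0 < k"
    and j: "j < J * 2 ^ m"
  shows "norm (w ((real j + 1) / 2 ^ m) - w (real j / 2 ^ m)) \<le> root k y * r ^ m"
proof -
  let ?f = "\<lambda>m j. ennreal ((norm (w ((real j + 1) / 2 ^ m) - w (real j / 2 ^ m)) / r ^ m) ^ k)"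
  have "?f m j \<le> (\<Sum>j<J * 2 ^ m. ?f m j)" by (rule member_le_sum) (use j in auto)
  also have "\<dots> \<le> hoelder_sum r k J w"
    unfolding hoelder_sum_def using sum_le_suminf[of "\<lambda>m. \<Sum>j<J * 2 ^ m. ?f m j" "{m}"] by simp
  finally have "(norm (w ((real j + 1) / 2 ^ m) - w (real j / 2 ^ m)) / r ^ m) ^ k \<le> root k y ^ k"
    using fin y k by (simp add: ennreal_le_iff)
  then have "norm (w ((real j + 1) / 2 ^ m) - w (real j / 2 ^ m)) / r ^ m \<le> root k y"
    using y k r by (subst (asm) power_mono_iff) auto
  then show ?thesis using r by (simp add: pos_divide_le_eq)
qed

definition dyadic_floor :: "nat \<Rightarrow> real \<Rightarrow> real" where
  "dyadic_floor m t = real (nat \<lfloor>t * 2 ^ m\<rfloor>) / 2 ^ m"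

lemma
  assumes "0 \<le> t"
  shows dyadic_floor_le: "dyadic_floor m t \<le> t"
    and less_dyadic_floor_add: "t < dyadic_floor m t + 1 / 2 ^ m"
proof -
  have "real (nat \<lfloor>t * 2 ^ m\<rfloor>) \<le> t * 2 ^ m" "t * 2 ^ m < real (nat \<lfloor>t * 2 ^ m\<rfloor>) + 1"
    using assms by auto
  then show "dyadic_floor m t \<le> t" "t < dyadic_floor m t + 1 / 2 ^ m"
    by (auto simp: dyadic_floor_def field_simps)
qed

lemma dyadic_floor_nonneg: "0 \<le> dyadic_floor m t"
  by (simp add: dyadic_floor_def)

lemma dyadic_floor_tendsto:
  assumes "0 \<le> t"
  shows "(\<lambda>m. dyadic_floor m t) \<longlonglongrightarrow> t"
proof (rule tendsto_sandwich)
  show "\<forall>\<^sub>F m in sequentially. t - (1 / 2) ^ m \<le> dyadic_floor m t"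
    using less_dyadic_floor_add[OF assms] by (auto simp: power_one_over diff_le_eq less_imp_le)
  show "\<forall>\<^sub>F m in sequentially. dyadic_floor m t \<le> t"
    using dyadic_floor_le[OF assms] by simp
  show "(\<lambda>m. t - (1 / 2) ^ m) \<longlonglongrightarrow> t"
    using tendsto_diff[OF tendsto_const[of t] LIMSEQ_power_zero[of "1 / 2 :: real"]] by simp
qed simp

locale dyadic_increments =
  fixes w :: "real \<Rightarrow> 'b::real_normed_vector" and B r :: real and J :: nat
  assumes cont: "continuous_on {0..} w" and B_nonneg: "0 \<le> B" and r: "0 < r" "r < 1"
    and increment: "j < J * 2 ^ m \<Longrightarrow> norm (w ((real j + 1) / 2 ^ m) - w (real j / 2 ^ m)) \<le> B * r ^ m"
begin

lemma dyadic_floor_Suc_increment: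
  assumes t: "0 \<le> t" "t < real J"
  shows "norm (w (dyadic_floor (Suc m) t) - w (dyadic_floor m t)) \<le> B * r ^ Suc m"
proof -
  define k where "k = (\<lambda>i. nat \<lfloor>t * 2 ^ i\<rfloor>)"
  have k: "real (k i) \<le> t * 2 ^ i" "t * 2 ^ i < real (k i) + 1" for i
    using t by (auto simp: k_def)
  have floor_k: "dyadic_floor i t = real (k i) / 2 ^ i" for i by (simp add: dyadic_floor_def k_def)
  have "real (k (Suc m)) < real (2 * k m + 2)" "real (2 * k m) < real (k (Suc m) + 1)"
    using k[of m] k[of "Suc m"] by auto
  then consider (left) "k (Suc m) = 2 * k m" | (right) "k (Suc m) = 2 * k m + 1"
    unfolding of_nat_less_iff by linarith
  then show ?thesis
  proof cases
    case left
    then show ?thesis using B_nonneg r by (simp add: floor_k)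
  next
    case right
    have "t * 2 ^ m < real J * 2 ^ m" using t by simp
    then have "real (k m) < real J * 2 ^ m" using k(1)[of m] by linarith
    then have "real (k m) < real (J * 2 ^ m)" by simp
    then have "2 * k m < J * 2 ^ Suc m" unfolding of_nat_less_iff by simp
    from increment[OF this] show ?thesis by (simp add: floor_k right add.commute)
  qed
qed

lemma chaining:
  assumes t: "0 \<le> t" "t < real J"
  shows "norm (w t - w (dyadic_floor m t)) \<le> r / (1 - r) * B * r ^ m"
proof -
  let ?d = "\<lambda>i. w (dyadic_floor i t)"
  have chain: "norm (?d (m + l) - ?d m) \<le> r / (1 - r) * B * r ^ m * (1 - r ^ l)" for l
  proof (induction l)
    case (Suc l)
    have "norm (?d (m + Suc l) - ?d m)
        \<le> norm (?d (Suc (m + l)) - ?d (m + l)) + norm (?d (m + l) - ?d m)"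
      using norm_triangle_ineq[of "?d (Suc (m + l)) - ?d (m + l)" "?d (m + l) - ?d m"] by simp
    also have "\<dots> \<le> B * r ^ Suc (m + l) + r / (1 - r) * B * r ^ m * (1 - r ^ l)"
      by (intro add_mono dyadic_floor_Suc_increment[OF t] Suc.IH)
    also have "\<dots> = r / (1 - r) * B * r ^ m * (1 - r ^ Suc l)"
      using r by (simp add: power_add field_simps)
    finally show ?case .
  qed simp
  have "(\<lambda>l. dyadic_floor (m + l) t) \<longlonglongrightarrow> t"
    by (subst add.commute) (rule LIMSEQ_ignore_initial_segment[OF dyadic_floor_tendsto[OF t(1)]])
  then have "(\<lambda>l. ?d (m + l)) \<longlonglongrightarrow> w t"
    by (rule continuous_on_tendsto_compose[OF cont]) (use t dyadic_floor_nonneg in auto)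
  then have "(\<lambda>l. norm (?d (m + l) - ?d m)) \<longlonglongrightarrow> norm (w t - ?d m)" by (intro tendsto_intros)
  moreover have "norm (?d (m + l) - ?d m) \<le> r / (1 - r) * B * r ^ m" for l
    by (rule order_trans[OF chain], rule mult_left_le) (use B_nonneg r in auto)
  ultimately show ?thesis by (intro LIMSEQ_le_const2) auto
qed

lemma modulus_of_continuity:
  assumes ts: "0 \<le> t" "t \<le> s" "s < real J" "s \<le> t + 1 / 2 ^ m"
  shows "norm (w s - w t) \<le> (1 + r) / (1 - r) * B * r ^ m"
proof -
  define k where "k = (\<lambda>t :: real. nat \<lfloor>t * 2 ^ m\<rfloor>)"
  have floor_k: "dyadic_floor m t = real (k t) / 2 ^ m" for t by (simp add: dyadic_floor_def k_def)
  have k: "real (k t) \<le> t * 2 ^ m" "t * 2 ^ m < real (k t) + 1"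
      "real (k s) \<le> s * 2 ^ m" "s * 2 ^ m < real (k s) + 1"
    using ts by (auto simp: k_def)
  have "t * 2 ^ m \<le> s * 2 ^ m" "s * 2 ^ m \<le> t * 2 ^ m + 1" "s * 2 ^ m < real J * 2 ^ m"
    using ts by (auto simp: field_simps)
  with k have "real (k t) < real (k s) + 1" "real (k s) < real (k t) + 2"
      "real (k t) < real J * 2 ^ m"
    by linarith+
  then have "real (k t) < real (k s + 1)" "real (k s) < real (k t + 2)"
      "real (k t) < real (J * 2 ^ m)"
    by simp_all
  then have "k s = k t \<or> k s = k t + 1" and "k t < J * 2 ^ m" unfolding of_nat_less_iff by auto
  then have grid: "norm (w (dyadic_floor m s) - w (dyadic_floor m t)) \<le> B * r ^ m"
    using increment[of "k t" m] B_nonneg r by (auto simp: floor_k add.commute)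
  have "w s - w t = (w s - w (dyadic_floor m s)) - (w t - w (dyadic_floor m t))
      + (w (dyadic_floor m s) - w (dyadic_floor m t))" by simp
  also have "norm \<dots> \<le> norm (w s - w (dyadic_floor m s)) + norm (w t - w (dyadic_floor m t))
      + norm (w (dyadic_floor m s) - w (dyadic_floor m t))"
    by (rule order_trans[OF norm_triangle_ineq add_right_mono[OF norm_triangle_ineq4]])
  also have "\<dots> \<le> r / (1 - r) * B * r ^ m + r / (1 - r) * B * r ^ m + B * r ^ m"
    using ts by (intro add_mono chaining grid) auto
  also have "\<dots> = (2 * (r / (1 - r)) + 1) * B * r ^ m" by (simp add: algebra_simps)
  also have "2 * (r / (1 - r)) + 1 = (1 + r) / (1 - r)" using r by (simp add: field_simps)
  finally show ?thesis .
qed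

end

text \<open>The ratio \<open>4/5\<close> exceeds \<open>1/\<surd>2\<close>, as required by the moments of Brownian motion, and its
  eighth power is less than \<open>1/4\<close>.\<close>

lemma dyadic_scale:
  assumes a: "0 \<le> a"
  obtains m where "a * (4 / 5 :: real) ^ m \<le> 1" "4 ^ m \<le> (1 + 5 / 4 * a) ^ 8"
proof -
  have "\<exists>m. a * (4 / 5) ^ m \<le> 1"
  proof -
    obtain m where "(4 / 5 :: real) ^ m < 1 / (a + 1)"
      using real_arch_pow_inv[of "1 / (a + 1)" "4 / 5"] a by auto
    then have "(a + 1) * (4 / 5) ^ m < 1" using a by (simp add: field_simps)
    then have "a * (4 / 5) ^ m \<le> 1"
      using zero_le_power[of "4 / 5 :: real" m] unfolding distrib_right by linarith
    then show ?thesis ..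
  qed
  then obtain m where m: "a * (4 / 5) ^ m \<le> 1" and least: "\<And>i. i < m \<Longrightarrow> \<not> a * (4 / 5) ^ i \<le> 1"
    using exists_least_iff[of "\<lambda>m. a * (4 / 5) ^ m \<le> 1"] by blast
  have "(5 / 4) ^ m \<le> 1 + 5 / 4 * a"
  proof (cases m)
    case (Suc i)
    then have "1 < a * (4 / 5) ^ i" using least[of i] by simp
    then have "1 * (5 / 4) ^ i < a * (4 / 5) ^ i * (5 / 4) ^ i" by (rule mult_strict_right_mono) simp
    then show ?thesis using Suc by (simp add: mult.assoc flip: power_mult_distrib)
  qed (use a in simp)
  then have "((5 / 4) ^ m) ^ 8 \<le> (1 + 5 / 4 * a) ^ 8" by (intro power_mono) auto
  moreover have "(4::real) ^ m \<le> ((5 / 4) ^ 8) ^ m" by (intro power_mono) (auto simp: power_divide)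
  ultimately have "4 ^ m \<le> (1 + 5 / 4 * a) ^ 8" by (simp add: mult.commute flip: power_mult)
  with m show thesis by (rule that)
qed

lemma power_one_plus_le:
  fixes b :: real
  assumes "0 \<le> b"
  shows "(1 + b) ^ k \<le> 2 ^ k * (1 + b ^ k)"
proof -
  have "(1 + b) ^ k \<le> (2 * max 1 b) ^ k" using assms by (intro power_mono) auto
  also have "\<dots> = 2 ^ k * max 1 b ^ k" by (rule power_mult_distrib)
  also have "max 1 b ^ k \<le> 1 + b ^ k" using assms by (cases "b \<le> 1") (auto simp: max_def)
  finally show ?thesis by simp
qed

definition modulus_const :: "real \<Rightarrow> nat \<Rightarrow> real" where
  "modulus_const \<theta> n = 2 ^ n * (2 * (1 + 12 / \<theta>)) ^ (8 * n)"

lemma dyadic_scale_power_le: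
  assumes \<theta>: "0 < \<theta>" and B: "0 \<le> B" and scale: "4 ^ m \<le> (1 + 5 / 4 * (9 * B / \<theta>)) ^ 8"
  shows "(1 + 4 ^ m) ^ n \<le> modulus_const \<theta> n * (1 + B ^ (8 * n))"
proof -
  define c where "c = 1 + 12 / \<theta>"
  have "1 \<le> c" using \<theta> by (simp add: c_def)
  have "1 + 5 / 4 * (9 * B / \<theta>) \<le> 1 + 12 / \<theta> * B" using B \<theta> by (simp add: field_simps)
  also have "\<dots> \<le> c * (1 + B)" using B \<theta> by (simp add: c_def distrib_left distrib_right)
  finally have "(1 + 5 / 4 * (9 * B / \<theta>)) ^ 8 \<le> (c * (1 + B)) ^ 8"
    using B \<theta> by (intro power_mono) auto
  moreover have "1 \<le> (c * (1 + B)) ^ 8"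
    using mult_mono[of 1 c 1 "1 + B"] \<open>1 \<le> c\<close> B by (intro one_le_power) simp
  ultimately have "1 + 4 ^ m \<le> 2 * (c * (1 + B)) ^ 8" using scale by simp
  then have "(1 + 4 ^ m) ^ n \<le> (2 * (c * (1 + B)) ^ 8) ^ n" by (intro power_mono) auto
  also have "\<dots> = 2 ^ n * c ^ (8 * n) * (1 + B) ^ (8 * n)"
    by (simp add: power_mult_distrib flip: power_mult)
  also have "\<dots> \<le> 2 ^ n * c ^ (8 * n) * (2 ^ (8 * n) * (1 + B ^ (8 * n)))"
    using power_one_plus_le[OF B] \<open>1 \<le> c\<close> by (intro mult_left_mono) auto
  finally show ?thesis by (simp only: modulus_const_def c_def power_mult_distrib mult_ac)
qed

lemma hoelder_sum_imp_oscillation_le: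
  fixes w :: "real \<Rightarrow> 'b::real_normed_vector"
  assumes w: "continuous_on {0..} w" and \<theta>: "0 < \<theta>" and n: "1 \<le> n" and J: "T + 1 < real J"
    and y: "hoelder_sum (4 / 5) (8 * n) J w = ennreal y" "0 \<le> y"
  obtains \<delta> where "0 < \<delta>" "oscillation_le w T \<delta> \<theta>" "(1 + 1 / \<delta>\<^sup>2) ^ n \<le> modulus_const \<theta> n * (1 + y)"
proof -
  define B where "B = root (8 * n) y"
  have B: "0 \<le> B" "B ^ (8 * n) = y" using n y(2) by (auto simp: B_def)
  interpret dyadic_increments w B "4 / 5" J
    using hoelder_sum_increment_le[OF y] n w B(1) by unfold_locales (auto simp: B_def)
  have "0 \<le> 9 * B / \<theta>" using B \<theta> by simp
  then obtain m where m: "9 * B / \<theta> * (4 / 5) ^ m \<le> 1"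
    and scale: "4 ^ m \<le> (1 + 5 / 4 * (9 * B / \<theta>)) ^ 8"
    by (rule dyadic_scale)
  show thesis
  proof
    show "oscillation_le w T (1 / 2 ^ m) \<theta>"
      unfolding oscillation_le_def
    proof (intro ballI)
      fix t s assume ts: "t \<in> {0..T}" "s \<in> {t..t + 1 / 2 ^ m}"
      have "1 / 2 ^ m \<le> (1::real)" by simp
      moreover have "s \<le> t + 1 / 2 ^ m" "t \<le> T" using ts by auto
      ultimately have "s < real J" using J by linarith
      then have "dist (w s) (w t) \<le> 9 * B * (4 / 5) ^ m"
        using modulus_of_continuity[of t s m] ts by (simp add: dist_norm)
      also have "\<dots> \<le> \<theta>" using m \<theta> by (simp add: field_simps)
      finally show "dist (w s) (w t) \<le> \<theta>" .
    qed
    have "1 / (1 / 2 ^ m)\<^sup>2 = (4::real) ^ m"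
      by (simp add: power_one_over power2_eq_square flip: power_mult_distrib)
    then show "(1 + 1 / (1 / 2 ^ m)\<^sup>2) ^ n \<le> modulus_const \<theta> n * (1 + y)"
      using dyadic_scale_power_le[OF \<theta> B(1) scale, of n] B(2) by simp
  qed simp
qed

lemma
  assumes "std_BM M W"
  shows std_BM_prob_space: "prob_space M"
    and std_BM_measurable: "W t \<in> borel_measurable M"
    and std_BM_zero: "\<omega> \<in> space M \<Longrightarrow> W 0 \<omega> = 0"
    and std_BM_continuous: "\<omega> \<in> space M \<Longrightarrow> continuous_on {0..} (\<lambda>t. W t \<omega>)"
    and std_BM_increment_distributed: "0 \<le> s \<Longrightarrow> s < t \<Longrightarrow>
          distributed M lborel (\<lambda>\<omega>. W t \<omega> - W s \<omega>) (\<lambda>x. ennreal (gauss_density (t - s) x))"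
  using assms unfolding std_BM_def by blast+

lemma power_le_fact_exp:
  fixes u :: real
  assumes "0 \<le> u"
  shows "u ^ j \<le> fact j * exp u"
proof -
  have "u ^ j / fact j \<le> exp u"
    using sum_le_suminf[OF summable_exp_generic[of u], of "{j}"] assms
    by (simp add: exp_def divide_inverse mult.commute)
  then show ?thesis by (simp add: field_simps)
qed

lemma gauss_density_double_variance:
  fixes x :: "'b::euclidean_space"
  assumes r: "0 < r"
  shows "exp ((norm x)\<^sup>2 / (4 * r)) * gauss_density r x
      = 2 powr (real DIM('b) / 2) * gauss_density (2 * r) x"
proof -
  let ?d = "real DIM('b) / 2"
  have scale: "(2 * pi * (2 * r)) powr - ?d = 2 powr - ?d * (2 * pi * r) powr - ?d"
    using r powr_mult[of 2 "2 * pi * r" "- ?d"] by (simp add: mult_ac)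
  have exps: "exp (- (norm x)\<^sup>2 / (2 * (2 * r)))
      = exp ((norm x)\<^sup>2 / (4 * r)) * exp (- (norm x)\<^sup>2 / (2 * r))"
    using r by (simp add: field_simps flip: exp_add)
  have "2 powr ?d * gauss_density (2 * r) x
      = (2 powr ?d * 2 powr - ?d) * (2 * pi * r) powr - ?d * exp (- (norm x)\<^sup>2 / (2 * (2 * r)))"
    using scale by (simp add: gauss_density_def mult.assoc)
  also have "\<dots> = exp ((norm x)\<^sup>2 / (4 * r)) * gauss_density r x"
    unfolding exps by (simp add: gauss_density_def flip: powr_add)
  finally show ?thesis by simp
qed

definition gauss_moment_const :: "'b::euclidean_space itself \<Rightarrow> nat \<Rightarrow> real" where
  "gauss_moment_const _ j = fact j * 4 ^ j * 2 powr (real DIM('b) / 2)"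

text \<open>Comparison with the density of twice the variance reduces Gaussian moments to total mass one.\<close>

lemma gauss_density_moment_le:
  fixes x :: "'b::euclidean_space"
  assumes r: "0 < r"
  shows "norm x ^ (2 * j) * gauss_density r x
      \<le> gauss_moment_const TYPE('b) j * r ^ j * gauss_density (2 * r) x"
proof -
  let ?u = "(norm x)\<^sup>2 / (4 * r)"
  have "norm x ^ (2 * j) = r ^ j * 4 ^ j * ?u ^ j"
    using r by (simp add: power_mult power_divide power_mult_distrib)
  also have "\<dots> \<le> r ^ j * 4 ^ j * (fact j * exp ?u)"
    using r by (intro mult_left_mono power_le_fact_exp) auto
  finally have "norm x ^ (2 * j) * gauss_density r x
      \<le> r ^ j * 4 ^ j * (fact j * exp ?u) * gauss_density r x"
    by (rule mult_right_mono) (simp add: gauss_density_def)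
  also have "\<dots> = r ^ j * 4 ^ j * fact j * (exp ?u * gauss_density r x)" by (simp add: mult.assoc)
  also have "\<dots> = gauss_moment_const TYPE('b) j * r ^ j * gauss_density (2 * r) x"
    unfolding gauss_density_double_variance[OF r] gauss_moment_const_def by (simp add: mult_ac)
  finally show ?thesis .
qed

lemma std_BM_increment_moment:
  fixes W :: "real \<Rightarrow> 'a \<Rightarrow> 'b::euclidean_space"
  assumes BM: "std_BM M W" and st: "0 \<le> s" "s < t"
  shows "(\<integral>\<^sup>+\<omega>. ennreal (norm (W t \<omega> - W s \<omega>) ^ (2 * j)) \<partial>M)
      \<le> ennreal (gauss_moment_const TYPE('b) j * (t - s) ^ j)"
proof -
  interpret prob_space M by (rule std_BM_prob_space[OF BM])
  let ?r = "t - s" and ?C = "gauss_moment_const TYPE('b) j * (t - s) ^ j"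
  have r: "0 < ?r" "0 \<le> ?C" using st by (auto simp: gauss_moment_const_def)
  have nonneg: "0 \<le> gauss_density a x" for a and x :: 'b by (simp add: gauss_density_def)
  have [measurable]: "(gauss_density a :: 'b \<Rightarrow> real) \<in> borel_measurable borel" for a :: real
    unfolding gauss_density_def[abs_def] by measurable
  have mass: "(\<integral>\<^sup>+x. ennreal (gauss_density (2 * ?r) (x::'b)) \<partial>lborel) = 1"
    using distributed_nn_integral[OF std_BM_increment_distributed[OF BM, of 0 "2 * ?r"], of "\<lambda>_. 1"] r
    by (simp add: emeasure_space_1)
  have "(\<integral>\<^sup>+\<omega>. ennreal (norm (W t \<omega> - W s \<omega>) ^ (2 * j)) \<partial>M)
      = (\<integral>\<^sup>+x. ennreal (gauss_density ?r (x::'b)) * ennreal (norm x ^ (2 * j)) \<partial>lborel)"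
    using distributed_nn_integral[OF std_BM_increment_distributed[OF BM st],
      of "\<lambda>x. ennreal (norm x ^ (2 * j))"] by simp
  also have "\<dots> \<le> (\<integral>\<^sup>+x. ennreal ?C * ennreal (gauss_density (2 * ?r) (x::'b)) \<partial>lborel)"
  proof (rule nn_integral_mono)
    show "ennreal (gauss_density ?r x) * ennreal (norm x ^ (2 * j))
        \<le> ennreal ?C * ennreal (gauss_density (2 * ?r) x)"
      for x :: 'b
      using gauss_density_moment_le[OF r(1), of x j] r(2) nonneg
      by (simp add: mult.commute[of "gauss_density _ _"] flip: ennreal_mult)
  qed
  also have "\<dots> = ennreal ?C" by (subst nn_integral_cmult, measurable) (simp only: mass mult_1_right)
  finally show ?thesis .
qed

lemma std_BM_hoelder_sum_finite:
  fixes W :: "real \<Rightarrow> 'a \<Rightarrow> 'b::euclidean_space"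
  assumes BM: "std_BM M W" and n: "1 \<le> n"
  shows "(\<integral>\<^sup>+\<omega>. hoelder_sum (4 / 5) (8 * n) J (\<lambda>t. W t \<omega>) \<partial>M) < \<infinity>"
proof (rule nn_integral_hoelder_sum_finite[where l = "4 * n"])
  have "(2::real) < ((4 / 5) ^ 8 * 2 ^ 4) ^ 1" by (simp add: power_divide)
  also have "\<dots> \<le> ((4 / 5) ^ 8 * 2 ^ 4) ^ n"
    by (rule power_increasing) (use n in \<open>auto simp: power_divide\<close>)
  finally show "2 < (4 / 5 :: real) ^ (8 * n) * 2 ^ (4 * n)"
    by (simp only: power_mult power_mult_distrib)
  show "0 \<le> gauss_moment_const TYPE('b) (4 * n)" by (simp add: gauss_moment_const_def)
qed (use std_BM_measurable[OF BM] std_BM_increment_moment[OF BM, of _ _ "4 * n"] in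
    \<open>simp_all add: mult.assoc[symmetric]\<close>)

section \<open>Convergence along sequences of velocities\<close>

lemma cSUP_tendsto_zero:
  fixes f :: "'i \<Rightarrow> 'a \<Rightarrow> real"
  assumes "uniform_limit A f (\<lambda>_. 0) \<F>" and "A \<noteq> {}"
  shows "((\<lambda>i. SUP t\<in>A. f i t) \<longlongrightarrow> 0) \<F>"
proof (rule tendstoI)
  fix e :: real assume "0 < e"
  then have "\<forall>\<^sub>F i in \<F>. \<forall>t\<in>A. dist (f i t) 0 < e / 2" by (intro uniform_limitD[OF assms(1)]) simp
  then show "\<forall>\<^sub>F i in \<F>. dist (SUP t\<in>A. f i t) 0 < e"
  proof eventually_elim
    case (elim i)
    have "\<bar>SUP t\<in>A. f i t\<bar> \<le> e / 2"
      using elim assms(2) by (intro cSup_abs_le) (auto intro: less_imp_le)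
    then show ?case using \<open>0 < e\<close> by simp
  qed
qed

lemma uniform_limit_power_sum_zero:
  fixes a b :: "'i \<Rightarrow> 'a \<Rightarrow> real"
  assumes lim: "uniform_limit A (\<lambda>i t. a i t + b i t) (\<lambda>_. 0) \<F>"
    and nonneg: "\<And>i t. 0 \<le> a i t" "\<And>i t. 0 \<le> b i t" and n: "1 \<le> n"
  shows "uniform_limit A (\<lambda>i t. a i t ^ n + b i t ^ n) (\<lambda>_. 0) \<F>"
proof (rule metric_uniform_limit_imp_uniform_limit[OF lim])
  have "\<forall>\<^sub>F i in \<F>. \<forall>t\<in>A. dist (a i t + b i t) 0 < 1" by (rule uniform_limitD[OF lim]) simp
  then show "\<forall>\<^sub>F i in \<F>. \<forall>t\<in>A. dist (a i t ^ n + b i t ^ n) 0 \<le> dist (a i t + b i t) 0"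
  proof eventually_elim
    case (elim i)
    have "a i t ^ n + b i t ^ n \<le> a i t + b i t" if "t \<in> A" for t
    proof -
      have "a i t \<le> 1" "b i t \<le> 1" using elim that nonneg[of i t] by (auto simp: dist_norm)
      then show ?thesis
        using power_decreasing[OF n, of "a i t"] power_decreasing[OF n, of "b i t"] nonneg[of i t]
        by simp
    qed
    then show ?case using nonneg by simp
  qed
qed

lemma (in prob_space) AE_tendsto_zero_imp_prob_tendsto_zero:
  assumes Z [measurable]: "\<And>i :: nat. Z i \<in> borel_measurable M"
    and lim: "AE \<omega> in M. (\<lambda>i. Z i \<omega>) \<longlonglongrightarrow> (0::real)" and \<xi>: "0 < \<xi>"
  shows "(\<lambda>i. prob {\<omega> \<in> space M. Z i \<omega> > \<xi>}) \<longlonglongrightarrow> 0"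
proof -
  let ?A = "\<lambda>i. {\<omega> \<in> space M. Z i \<omega> > \<xi>}"
  have "(\<lambda>i. \<integral>\<omega>. indicat_real (?A i) \<omega> \<partial>M) \<longlonglongrightarrow> (\<integral>\<omega>. 0 \<partial>M)"
  proof (rule integral_dominated_convergence[where w = "\<lambda>_. 1"])
    show "AE \<omega> in M. (\<lambda>i. indicat_real (?A i) \<omega>) \<longlonglongrightarrow> 0"
      using lim
    proof eventually_elim
      case (elim \<omega>)
      have "\<forall>\<^sub>F i in sequentially. Z i \<omega> < \<xi>" by (rule order_tendstoD(2)[OF elim \<xi>])
      then show ?case by (intro tendsto_eventually) (auto elim: eventually_mono)
    qed
  qed (auto split: split_indicator)
  then show ?thesis by simp
qed

lemma borel_measurable_cSUP_Icc:
  fixes f :: "real \<Rightarrow> 'a \<Rightarrow> real"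
  assumes meas: "\<And>t. f t \<in> borel_measurable M" and T: "0 < T"
    and cont: "\<And>\<omega>. \<omega> \<in> space M \<Longrightarrow> continuous_on {0..T} (\<lambda>t. f t \<omega>)"
  shows "(\<lambda>\<omega>. SUP t\<in>{0..T}. f t \<omega>) \<in> borel_measurable M"
proof -
  define D where "D = {0<..<T} \<inter> \<rat>"
  have closure_D: "closure D = {0..T}"
    unfolding D_def using T by (subst closure_open_Int_superset) (auto simp: Rats_closure_real)
  have "D \<noteq> {}" using T closure_D by force
  have "D \<subseteq> {0..T}" "countable D" by (auto simp: D_def countable_rat intro: countable_Int2)
  have bdd: "bdd_above ((\<lambda>t. f t \<omega>) ` {0..T})" if "\<omega> \<in> space M" for \<omega>
    by (intro bounded_imp_bdd_above compact_imp_bounded compact_continuous_image cont that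
        compact_Icc)
  have bdd_D: "bdd_above ((\<lambda>t. f t \<omega>) ` D)" if "\<omega> \<in> space M" for \<omega>
    by (rule bdd_above_mono[OF bdd[OF that]]) (use \<open>D \<subseteq> {0..T}\<close> in auto)
  have "(SUP t\<in>{0..T}. f t \<omega>) = (SUP t\<in>D. f t \<omega>)" if \<omega>: "\<omega> \<in> space M" for \<omega>
  proof (rule antisym)
    show "(SUP t\<in>{0..T}. f t \<omega>) \<le> (SUP t\<in>D. f t \<omega>)"
    proof (rule cSUP_least)
      fix t assume "t \<in> {0..T}"
      then show "f t \<omega> \<le> (SUP t\<in>D. f t \<omega>)"
        using continuous_le_on_closure[of D "\<lambda>t. f t \<omega>" t "SUP t\<in>D. f t \<omega>"] cont[OF \<omega>]
          cSUP_upper[OF _ bdd_D[OF \<omega>]]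
        by (simp add: closure_D)
    qed (use T in auto)
    show "(SUP t\<in>D. f t \<omega>) \<le> (SUP t\<in>{0..T}. f t \<omega>)"
      by (rule cSUP_subset_mono[OF \<open>D \<noteq> {}\<close> bdd[OF \<omega>] \<open>D \<subseteq> {0..T}\<close>]) simp
  qed
  moreover have "(\<lambda>\<omega>. SUP t\<in>D. f t \<omega>) \<in> borel_measurable M"
    by (rule borel_measurable_cSUP[OF \<open>countable D\<close> meas bdd_D])
  ultimately show ?thesis by (simp cong: measurable_cong)
qed

lemma
  assumes "solves M vel F S W q0 p0 q p"
  shows solves_measurable: "q t \<in> borel_measurable M" "p t \<in> borel_measurable M"
    and solves_continuous: "\<omega> \<in> space M \<Longrightarrow> continuous_on {0..} (\<lambda>t. q t \<omega>)"
      "\<omega> \<in> space M \<Longrightarrow> continuous_on {0..} (\<lambda>t. p t \<omega>)"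
  using assms unfolding solves_def by blast+

locale approximating_solutions = prob_space M
  for M :: "'a measure" +
  fixes vel :: "'v::euclidean_space \<Rightarrow> 'v" and F :: "'v \<Rightarrow> 'v" and S :: "'v set"
    and W :: "real \<Rightarrow> 'a \<Rightarrow> 'v" and q0 p0 :: 'v and q p :: "real \<Rightarrow> 'a \<Rightarrow> 'v"
    and vel' :: "nat \<Rightarrow> 'v \<Rightarrow> 'v" and q' p' :: "nat \<Rightarrow> real \<Rightarrow> 'a \<Rightarrow> 'v" and T :: real
  assumes open_S: "open S" and F_lipschitz: "locally_lipschitz_on S F" and T_pos: "0 < T"
    and sol: "solves M vel F S W q0 p0 q p"
    and sol': "\<And>i. solves M (vel' i) F S W q0 p0 (q' i) (p' i)"
    and cont_vel: "continuous_on UNIV vel"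
    and vel'_lipschitz: "\<And>i. 1-lipschitz_on UNIV (vel' i)"
    and vel'_limit: "\<And>R. uniform_limit (cball 0 R) vel' vel sequentially"
begin

definition sup_error :: "nat \<Rightarrow> nat \<Rightarrow> 'a \<Rightarrow> real" where
  "sup_error n i \<omega> = (SUP t\<in>{0..T}. norm (q' i t \<omega> - q t \<omega>) ^ n + norm (p' i t \<omega> - p t \<omega>) ^ n)"

lemma sup_error_measurable [measurable]: "sup_error n i \<in> borel_measurable M"
proof -
  note [measurable] = solves_measurable[OF sol] solves_measurable[OF sol']
  show ?thesis
    unfolding sup_error_def[abs_def]
  proof (rule borel_measurable_cSUP_Icc[OF _ T_pos])
    fix \<omega> assume "\<omega> \<in> space M"
    then show "continuous_on {0..T} (\<lambda>t. norm (q' i t \<omega> - q t \<omega>) ^ n + norm (p' i t \<omega> - p t \<omega>) ^ n)"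
      by (intro continuous_intros; auto intro: continuous_on_subset[of "{0..}"]
          solves_continuous[OF sol] solves_continuous[OF sol'])
  qed measurable
qed

theorem AE_sup_error_tendsto_zero:
  assumes n: "1 \<le> n"
  shows "AE \<omega> in M. (\<lambda>i. sup_error n i \<omega>) \<longlonglongrightarrow> 0"
proof -
  have "AE \<omega> in M. \<forall>i. path_sol (vel' i) F S (\<lambda>t. W t \<omega>) q0 p0 (\<lambda>t. q' i t \<omega>) (\<lambda>t. p' i t \<omega>)"
    unfolding AE_all_countable by (intro allI solves_imp_AE_path_sol sol')
  with solves_imp_AE_path_sol[OF sol] show ?thesis
  proof eventually_elim
    case (elim \<omega>)
    have "uniform_limit {0..T}
        (\<lambda>i t. norm (q' i t \<omega> - q t \<omega>) + norm (p' i t \<omega> - p t \<omega>)) (\<lambda>_. 0) sequentially"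
      by (rule path_sol_uniform_limit[OF open_S F_lipschitz cont_vel elim(1) _ vel'_limit])
        (use elim(2) vel'_lipschitz in auto)
    then have "uniform_limit {0..T}
        (\<lambda>i t. norm (q' i t \<omega> - q t \<omega>) ^ n + norm (p' i t \<omega> - p t \<omega>) ^ n) (\<lambda>_. 0) sequentially"
      by (rule uniform_limit_power_sum_zero[OF _ _ _ n]) auto
    then show ?case unfolding sup_error_def by (rule cSUP_tendsto_zero) (use T_pos in auto)
  qed
qed

theorem prob_sup_error_tendsto_zero:
  assumes "0 < \<xi>"
  shows "(\<lambda>i. prob {\<omega> \<in> space M. sup_error 1 i \<omega> > \<xi>}) \<longlonglongrightarrow> 0"
  by (rule AE_tendsto_zero_imp_prob_tendsto_zero[OF _ AE_sup_error_tendsto_zero assms]) auto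

lemma sup_error_le:
  assumes "\<And>t. t \<in> {0..T} \<Longrightarrow> norm (q t \<omega>) \<le> X \<and> norm (p t \<omega>) \<le> X"
    and "\<And>t. t \<in> {0..T} \<Longrightarrow> norm (q' i t \<omega>) \<le> X \<and> norm (p' i t \<omega>) \<le> X"
  shows "sup_error n i \<omega> \<le> 2 * (2 * X) ^ n"
  unfolding sup_error_def
proof (rule cSUP_least)
  fix t assume t: "t \<in> {0..T}"
  have "norm (q' i t \<omega> - q t \<omega>) \<le> 2 * X" "norm (p' i t \<omega> - p t \<omega>) \<le> 2 * X"
    using assms[OF t] norm_triangle_ineq4[of "q' i t \<omega>" "q t \<omega>"]
      norm_triangle_ineq4[of "p' i t \<omega>" "p t \<omega>"]
    by linarith+
  then have "norm (q' i t \<omega> - q t \<omega>) ^ n + norm (p' i t \<omega> - p t \<omega>) ^ n \<le> (2 * X) ^ n + (2 * X) ^ n"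
    by (intro add_mono power_mono) auto
  then show "norm (q' i t \<omega> - q t \<omega>) ^ n + norm (p' i t \<omega> - p t \<omega>) ^ n \<le> 2 * (2 * X) ^ n"
    by (simp only: mult_2[of "(2 * X) ^ n"])
qed (use T_pos in auto)

theorem nn_integral_sup_error_dominated_tendsto_zero:
  assumes n: "1 \<le> n" and Y [measurable]: "Y \<in> borel_measurable M"
    and integrable: "(\<integral>\<^sup>+\<omega>. Y \<omega> \<partial>M) < \<infinity>" and bound: "\<And>i. AE \<omega> in M. ennreal (sup_error n i \<omega>) \<le> Y \<omega>"
  shows "(\<lambda>i. \<integral>\<^sup>+\<omega>. ennreal (sup_error n i \<omega>) \<partial>M) \<longlonglongrightarrow> 0"
proof -
  have "(\<lambda>i. \<integral>\<^sup>+\<omega>. ennreal (sup_error n i \<omega>) \<partial>M) \<longlonglongrightarrow> (\<integral>\<^sup>+\<omega>. 0 \<partial>M)"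
  proof (rule nn_integral_dominated_convergence[OF _ _ Y bound integrable])
    show "AE \<omega> in M. (\<lambda>i. ennreal (sup_error n i \<omega>)) \<longlonglongrightarrow> 0"
      using AE_sup_error_tendsto_zero[OF n]
    proof eventually_elim
      case (elim \<omega>)
      from tendsto_ennrealI[OF elim] show ?case by simp
    qed
  qed auto
  then show ?thesis by simp
qed

end

locale one_particle_approximation =
  confining_repulsive U gradU G gradG A \<beta> \<gamma> +
  approximating_solutions M vel "\<lambda>x. gradU x + gradG x" "- {0}" W q0 p0 q p vel' q' p' T
  for U :: "'v::euclidean_space \<Rightarrow> real" and gradU G gradG A \<beta> \<gamma> and M :: "'a measure"
    and vel W q0 p0 q p vel' q' p' T +
  fixes K :: "'v \<Rightarrow> real" and K' :: "nat \<Rightarrow> 'v \<Rightarrow> real"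
  assumes BM: "std_BM M W"
    and kinetic_vel: "kinetic_energy vel K" and kinetic_vel': "\<And>i. kinetic_energy (vel' i) (K' i)"
begin

definition tolerance :: real where
  "tolerance = noise_tolerance T / sqrt 2"

lemma path_le:
  assumes "kinetic_energy v E" and \<delta>: "0 < \<delta>" "oscillation_le (\<lambda>t. W t \<omega>) T \<delta> tolerance"
    and path: "path_sol v (\<lambda>x. gradU x + gradG x) (- {0}) (\<lambda>t. W t \<omega>) q0 p0 x y"
    and \<omega>: "\<omega> \<in> space M" and t: "t \<in> {0..T}"
  shows "norm (x t) \<le> path_bound T q0 p0 * (1 + 1 / \<delta>\<^sup>2)
    \<and> norm (y t) \<le> path_bound T q0 p0 * (1 + 1 / \<delta>\<^sup>2)"
proof -
  interpret kinetic_energy v E by fact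
  interpret one_particle_path U gradU G gradG A \<beta> \<gamma> v E T \<delta> "\<lambda>t. W t \<omega>" x y q0 p0
    by unfold_locales
      (use T_pos \<delta> path \<omega> std_BM_zero[OF BM] std_BM_continuous[OF BM]
          local_lipschitz_continuous_on[OF F_lipschitz UNIV_I]
        in \<open>auto simp: tolerance_def\<close>)
  show ?thesis using norm_path_le[OF t] by blast
qed

definition moment_const :: "nat \<Rightarrow> real" where
  "moment_const n = 2 * (2 * \<bar>path_bound T q0 p0\<bar>) ^ n * modulus_const tolerance n"

lemma tolerance_pos: "0 < tolerance"
  using T_pos noise_tolerance_pos by (simp add: tolerance_def)

lemma moment_const_nonneg: "0 \<le> moment_const n"
  using tolerance_pos by (simp add: moment_const_def modulus_const_def)

lemma AE_sup_error_le_hoelder_sum: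
  assumes n: "1 \<le> n" and J: "T + 1 < real J"
    and finite: "AE \<omega> in M. hoelder_sum (4 / 5) (8 * n) J (\<lambda>t. W t \<omega>) \<noteq> \<infinity>"
  shows "AE \<omega> in M. ennreal (sup_error n i \<omega>)
    \<le> ennreal (moment_const n) * (1 + hoelder_sum (4 / 5) (8 * n) J (\<lambda>t. W t \<omega>))"
  using finite AE_space solves_imp_AE_path_sol[OF sol] solves_imp_AE_path_sol[OF sol'[of i]]
proof eventually_elim
  case (elim \<omega>)
  let ?H = "hoelder_sum (4 / 5) (8 * n) J (\<lambda>t. W t \<omega>)" and ?B = "\<bar>path_bound T q0 p0\<bar>"
  define y where "y = enn2real ?H"
  have y: "?H = ennreal y" "0 \<le> y" using elim(1) by (auto simp: y_def top.not_eq_extremum)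
  obtain \<delta> where \<delta>: "0 < \<delta>" "oscillation_le (\<lambda>t. W t \<omega>) T \<delta> tolerance"
    and moment: "(1 + 1 / \<delta>\<^sup>2) ^ n \<le> modulus_const tolerance n * (1 + y)"
    using hoelder_sum_imp_oscillation_le[OF std_BM_continuous[OF BM elim(2)] tolerance_pos n J y]
    by blast
  define X where "X = 1 + 1 / \<delta>\<^sup>2"
  have "path_bound T q0 p0 * X \<le> ?B * X" by (simp add: X_def mult_right_mono)
  then have "sup_error n i \<omega> \<le> 2 * (2 * (?B * X)) ^ n"
    using path_le[OF kinetic_vel \<delta> elim(3,2)] path_le[OF kinetic_vel' \<delta> elim(4,2)]
    by (intro sup_error_le) (auto simp: X_def intro: order_trans)
  also have "\<dots> = 2 * (2 * ?B) ^ n * X ^ n" by (simp add: power_mult_distrib)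
  also have "\<dots> \<le> 2 * (2 * ?B) ^ n * (modulus_const tolerance n * (1 + y))"
    using moment by (intro mult_left_mono) (auto simp: X_def)
  also have "\<dots> = moment_const n * (1 + y)" by (simp add: moment_const_def mult.assoc)
  finally have "ennreal (sup_error n i \<omega>) \<le> ennreal (moment_const n * (1 + y))" by (rule ennreal_leI)
  also have "\<dots> = ennreal (moment_const n) * (1 + ?H)"
    using moment_const_nonneg y by (simp add: ennreal_mult)
  finally show ?case .
qed

theorem nn_integral_sup_error_tendsto_zero:
  assumes n: "1 \<le> n"
  shows "(\<lambda>i. \<integral>\<^sup>+\<omega>. ennreal (sup_error n i \<omega>) \<partial>M) \<longlonglongrightarrow> 0"
proof -
  obtain J :: nat where J: "T + 1 < real J" using reals_Archimedean2 by blast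
  let ?H = "\<lambda>\<omega>. hoelder_sum (4 / 5) (8 * n) J (\<lambda>t. W t \<omega>)"
  have [measurable]: "?H \<in> borel_measurable M"
    by (intro hoelder_sum_measurable std_BM_measurable[OF BM])
  have integrable: "(\<integral>\<^sup>+\<omega>. ?H \<omega> \<partial>M) < \<infinity>" by (rule std_BM_hoelder_sum_finite[OF BM n])
  then have finite: "AE \<omega> in M. ?H \<omega> \<noteq> \<infinity>" by (intro nn_integral_PInf_AE) auto
  show ?thesis
  proof (rule nn_integral_sup_error_dominated_tendsto_zero[OF n _ _
      AE_sup_error_le_hoelder_sum[OF n J finite]])
    show "(\<integral>\<^sup>+ \<omega>. ennreal (moment_const n) * (1 + ?H \<omega>) \<partial>M) < \<infinity>"
      using integrable
      by (simp add: nn_integral_cmult nn_integral_add emeasure_space_1 ennreal_mult_less_top)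
  qed measurable
qed

end

section \<open>The small-\<open>\<epsilon>\<close> limit\<close>

lemma multi_particle_convergence:
  fixes W :: "real \<Rightarrow> 'a \<Rightarrow> real^'d^'n"
  assumes M: "prob_space M"
    and gradU: "continuously_differentiable_on UNIV gradU"
    and gradG: "continuously_differentiable_on (- {0}) gradG"
    and sol': "\<And>\<epsilon>. \<epsilon> \<in> {0<..<1} \<Longrightarrow>
      solves M (rel_vel_multi \<epsilon>) (force_multi gradU gradG) coll_free W q0 p0 (qe \<epsilon>) (pe \<epsilon>)"
    and sol: "solves M (\<lambda>P. P) (force_multi gradU gradG) coll_free W q0 p0 q p"
    and T: "0 < T" and \<xi>: "0 < \<xi>"
  shows "((\<lambda>\<epsilon>. prob_space.prob M {\<omega> \<in> space M.
      (SUP t\<in>{0..T}. norm (qe \<epsilon> t \<omega> - q t \<omega>) + norm (pe \<epsilon> t \<omega> - p t \<omega>)) > \<xi>}) \<longlongrightarrow> 0) (at_right 0)"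
proof (rule tendsto_at_right_sequentially[of 0 1])
  fix X :: "nat \<Rightarrow> real" assume X: "\<And>i. 0 < X i" "\<And>i. X i < 1" "X \<longlonglongrightarrow> 0"
  have X_nonneg: "0 \<le> X i" for i using X(1)[of i] by simp
  interpret approximating_solutions M "\<lambda>P. P" "force_multi gradU gradG" coll_free W q0 p0 q p
    "\<lambda>i. rel_vel_multi (X i)" "\<lambda>i. qe (X i)" "\<lambda>i. pe (X i)" T
  proof (rule approximating_solutions.intro[OF M], unfold_locales)
    show "locally_lipschitz_on coll_free (force_multi gradU gradG :: real^'d^'n \<Rightarrow> _)"
      by (intro continuously_differentiable_on_imp_locally_lipschitz_on
          force_multi_continuously_differentiable gradU gradG open_coll_free)
    show "uniform_limit (cball 0 R) (\<lambda>i. rel_vel_multi (X i)) (\<lambda>P :: real^'d^'n. P) sequentially" for R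
      by (rule uniform_limit_cball_idI[OF dist_rel_vel_multi_id_le X(3)]) (use X_nonneg in auto)
  qed (use X X_nonneg sol sol' T in
      \<open>auto intro: open_coll_free rel_vel_multi_lipschitz continuous_on_id\<close>)
  show "(\<lambda>i. prob {\<omega> \<in> space M.
      (SUP t\<in>{0..T}. norm (qe (X i) t \<omega> - q t \<omega>) + norm (pe (X i) t \<omega> - p t \<omega>)) > \<xi>}) \<longlonglongrightarrow> 0"
    using prob_sup_error_tendsto_zero[OF \<xi>] by (simp add: sup_error_def)
qed simp

lemma one_particle_convergence:
  fixes W :: "real \<Rightarrow> 'a \<Rightarrow> real^'d"
  assumes potentials: "confining_repulsive U gradU G gradG A \<beta> \<gamma>"
    and gradU: "continuously_differentiable_on UNIV gradU"
    and gradG: "continuously_differentiable_on (- {0}) gradG"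
    and BM: "std_BM M W"
    and sol': "\<And>\<epsilon>. \<epsilon> \<in> {0<..<1} \<Longrightarrow>
      solves M (rel_vel \<epsilon>) (\<lambda>x. gradU x + gradG x) (- {0}) W q0 p0 (qe \<epsilon>) (pe \<epsilon>)"
    and sol: "solves M (\<lambda>P. P) (\<lambda>x. gradU x + gradG x) (- {0}) W q0 p0 q p"
    and T: "0 < T" and n: "1 \<le> n"
  shows "((\<lambda>\<epsilon>. \<integral>\<^sup>+ \<omega>. ennreal (SUP t\<in>{0..T}. norm (qe \<epsilon> t \<omega> - q t \<omega>) ^ n
      + norm (pe \<epsilon> t \<omega> - p t \<omega>) ^ n) \<partial>M) \<longlongrightarrow> 0) (at_right 0)"
proof (rule tendsto_at_right_sequentially[of 0 1])
  fix X :: "nat \<Rightarrow> real" assume X: "\<And>i. 0 < X i" "\<And>i. X i < 1" "X \<longlonglongrightarrow> 0"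
  have X_nonneg: "0 \<le> X i" for i using X(1)[of i] by simp
  have kinetic_rel: "kinetic_energy (rel_vel (X i) :: real^'d \<Rightarrow> _) (rel_energy (X i))" for i
    using X_nonneg X(2)[of i] by (intro kinetic_energy_rel) auto
  have kinetic_id: "kinetic_energy (\<lambda>P :: real^'d. P) (rel_energy 0)"
    using kinetic_energy_rel[of 0, where 'd = 'd] by (simp add: rel_vel_zero)
  interpret one_particle_approximation U gradU G gradG A \<beta> \<gamma> M "\<lambda>P. P" W q0 p0 q p
    "\<lambda>i. rel_vel (X i)" "\<lambda>i. qe (X i)" "\<lambda>i. pe (X i)" T "rel_energy 0" "\<lambda>i. rel_energy (X i)"
  proof (intro one_particle_approximation.intro one_particle_approximation_axioms.intro
      approximating_solutions.intro approximating_solutions_axioms.intro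
      potentials std_BM_prob_space[OF BM] BM kinetic_id kinetic_rel)
    show "locally_lipschitz_on (- {0}) (\<lambda>x. gradU x + gradG x)"
      by (intro continuously_differentiable_on_imp_locally_lipschitz_on
          continuously_differentiable_on_add gradG
          continuously_differentiable_on_subset[OF gradU]) auto
    show "uniform_limit (cball 0 R) (\<lambda>i. rel_vel (X i)) (\<lambda>P :: real^'d. P) sequentially" for R
      by (rule uniform_limit_cball_idI[OF _ X(3), of _ 1]) (use X_nonneg dist_rel_vel_id_le in auto)
  qed (use X X_nonneg sol sol' T in \<open>auto intro: rel_vel_lipschitz continuous_on_id\<close>)
  show "(\<lambda>i. \<integral>\<^sup>+ \<omega>. ennreal (SUP t\<in>{0..T}. norm (qe (X i) t \<omega> - q t \<omega>) ^ n
      + norm (pe (X i) t \<omega> - p t \<omega>) ^ n) \<partial>M) \<longlonglongrightarrow> 0"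
    using nn_integral_sup_error_tendsto_zero[OF n] by (simp add: sup_error_def)
qed simp

theorem theorem2p6:
  fixes U :: "real^'d \<Rightarrow> real" and gradU :: "real^'d \<Rightarrow> real^'d"
    and G :: "real^'d \<Rightarrow> real" and gradG :: "real^'d \<Rightarrow> real^'d"
    and a1 lam a2 a3 \<beta>1 \<beta>2 a4 a5 a6 :: real
  assumes U_smooth: "smooth_on UNIV U"
    and U_ge1: "\<forall>q. U q \<ge> 1"
    and U_grad: "\<forall>q. GDERIV U q :> gradU q"
    and a1_pos: "a1 > 0" and lam_ge1: "lam \<ge> 1" and a2_pos: "a2 > 0" and a3_pos: "a3 > 0"
    and U_bounds: "\<forall>q. (1 / a1) * norm q powr (lam + 1) - a1 \<le> \<bar>U q\<bar>
                      \<and> \<bar>U q\<bar> \<le> a1 * (1 + norm q powr (lam + 1))"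
    and gradU_bound: "\<forall>q. norm (gradU q) \<le> a1 * (1 + norm q powr lam)"
    and U_coercive: "\<forall>q. inner (gradU q) q \<ge> a2 * norm q powr (lam + 1) - a3"
    and G_smooth: "smooth_on (- {0}) G"
    and G_grad: "\<forall>q. q \<noteq> 0 \<longrightarrow> (GDERIV G q :> gradG q)"
    and G_sing: "filterlim G at_top (at 0)"
    and G_even: "\<forall>q. G (- q) = G q"
    and gradG_odd: "\<forall>q. q \<noteq> 0 \<longrightarrow> gradG (- q) = - gradG q"
    and beta1: "\<beta>1 \<ge> 1"
    and G_bound: "\<forall>q. q \<noteq> 0 \<longrightarrow> \<bar>G q\<bar> \<le> a1 * (1 + norm q + norm q powr (- \<beta>1))"
    and gradG_bound: "\<forall>q. q \<noteq> 0 \<longrightarrow> norm (gradG q) \<le> a1 * (1 + norm q powr (- \<beta>1))"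
    and beta2: "0 \<le> \<beta>2" "\<beta>2 < \<beta>1" and a4_pos: "a4 > 0" and a6_pos: "a6 > 0"
    and gradG_asym: "\<forall>q. q \<noteq> 0 \<longrightarrow>
        norm (gradG q + (a4 / norm q powr (\<beta>1 + 1)) *\<^sub>R q + (a5 / norm q powr (\<beta>2 + 1)) *\<^sub>R q) \<le> a6"
  shows
    "(\<forall>(M :: 'a measure) (W :: real \<Rightarrow> 'a \<Rightarrow> real^'d^'n) q0 p0
        (qe :: real \<Rightarrow> real \<Rightarrow> 'a \<Rightarrow> real^'d^'n) pe q p.
        CARD('n) \<ge> 2 \<longrightarrow> prob_space M \<longrightarrow> iid_BMs M W \<longrightarrow> q0 \<in> coll_free \<longrightarrow>
        (\<forall>\<epsilon>\<in>{0<..<1}. solves M (rel_vel_multi \<epsilon>) (force_multi gradU gradG) coll_free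
                                W q0 p0 (qe \<epsilon>) (pe \<epsilon>)) \<longrightarrow>
        solves M (\<lambda>P. P) (force_multi gradU gradG) coll_free W q0 p0 q p \<longrightarrow>
        (\<forall>T>0. \<forall>\<xi>>0.
           ((\<lambda>\<epsilon>. prob_space.prob M {\<omega> \<in> space M.
               (SUP t\<in>{0..T}. norm (qe \<epsilon> t \<omega> - q t \<omega>) + norm (pe \<epsilon> t \<omega> - p t \<omega>)) > \<xi>})
             \<longlongrightarrow> 0) (at_right 0)))
   \<and> (\<forall>(M :: 'b measure) (W :: real \<Rightarrow> 'b \<Rightarrow> real^'d) q0 p0
        (qe :: real \<Rightarrow> real \<Rightarrow> 'b \<Rightarrow> real^'d) pe q p.
        prob_space M \<longrightarrow> std_BM M W \<longrightarrow> q0 \<noteq> 0 \<longrightarrow>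
        (\<forall>\<epsilon>\<in>{0<..<1}. solves M (rel_vel \<epsilon>) (\<lambda>x. gradU x + gradG x) (- {0})
                                W q0 p0 (qe \<epsilon>) (pe \<epsilon>)) \<longrightarrow>
        solves M (\<lambda>P. P) (\<lambda>x. gradU x + gradG x) (- {0}) W q0 p0 q p \<longrightarrow>
        (\<forall>T>0. \<forall>n::nat. n \<ge> 1 \<longrightarrow>
           ((\<lambda>\<epsilon>. \<integral>\<^sup>+ \<omega>. ennreal (SUP t\<in>{0..T}. norm (qe \<epsilon> t \<omega> - q t \<omega>) ^ n
                                          + norm (pe \<epsilon> t \<omega> - p t \<omega>) ^ n) \<partial>M)
             \<longlongrightarrow> 0) (at_right 0)))"
proof -
  have gradU_C1: "continuously_differentiable_on UNIV gradU"
    using U_grad by (intro smooth_on_imp_gradient_continuously_differentiable[OF U_smooth]) auto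
  have gradG_C1: "continuously_differentiable_on (- {0}) gradG"
    using G_grad by (intro smooth_on_imp_gradient_continuously_differentiable[OF G_smooth]) auto
  have "\<bar>U q\<bar> = U q" for q using U_ge1[rule_format, of q] by simp
  then have "confining_potential U gradU a1 lam"
    using U_ge1 a1_pos lam_ge1 U_bounds gradU_bound by unfold_locales simp_all
  moreover have "repulsive_potential G gradG a1 \<beta>1 \<beta>2 a4 a5 a6"
    using a1_pos beta1 beta2 a4_pos G_sing G_bound gradG_asym by unfold_locales auto
  ultimately obtain A where potentials: "confining_repulsive U gradU G gradG A \<beta>1 (a4 / 2)"
    using U_grad G_grad gradG_bound beta1 by (elim exists_confining_repulsive) auto
  show ?thesis
    by (intro conjI allI impI multi_particle_convergence[OF _ gradU_C1 gradG_C1]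
        one_particle_convergence[OF potentials gradU_C1 gradG_C1]) blast+
qed

end
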